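(* Let $\alpha\in(0,1]$, $D^*\ge2$, and let $f_i:\mathbb{R}\times\mathbb{Z}\times\mathbb{Z}\to\mathbb{C}$, $i=1,2$, be square-integrable functions such that for all $(\tau_i,\xi_i,\eta_i)\in\operatorname{supp}(f_i)$, $i=1,2$, the following holds: $$|\xi_i|\sim N_i,\qquad |\tau_i-\omega(\xi_i,\eta_i)|\lesssim L_i,\qquad \Big|\frac{\eta_1}{\xi_1}-\frac{\eta_2}{\xi_2}\Big|\lesssim D^*,$$ for dyadic numbers $N_i,L_i\in2^{\mathbb{N}_0}$ satisfying $N_2\ll N_1$ and $N_1^\alpha\le L_{\max}\lesssim N_1^2N_2$, where $L_{\max}=\max(L_1,L_2)$. Then $$\|f_1*f_2\|_{L^2(\mathbb{R}\times\mathbb{Z}^2)}\lesssim\log(D^* )\big(N_2^{\frac12}N_1^{-\frac{\alpha}{2}}+N_2^{\frac14}N_1^{-\frac{\alpha}{4}}\big)\prod_{i=1}^2L_i^{\frac12}\|f_i\|_{L^2(\mathbb{R}\times\mathbb{Z}^2)}.$$ The implicit constant is independent of $D^*,N_i,L_i$ and $f_i$.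
   Context: $\omega(\xi,\eta)=\xi^3-\frac{\eta^2}{\xi}$ for $\xi\ne0$. $\mathbb{R}\times\mathbb{Z}^2$ carries the product of Lebesgue measure and counting measure; $L^2$ and the convolution $*$ are taken with respect to it. $A\lesssim B$ means $A\le CB$ for a fixed constant $C$, $A\sim B$ means $A\lesssim B\lesssim A$, and $A\ll B$ means $A\le cB$ with a fixed sufficiently small $c\in(0,1)$. *)

theory Defs
  imports "HOL-Analysis.Analysis"
begin

text \<open>Coordinates \<open>(\<tau>, \<xi>, \<eta>)\<close> range over \<open>real \<times> int \<times> int\<close>. The first factor carries
  \<open>lebesgue\<close> (not only \<open>lborel\<close>), so square-integrable functions need only be
  Lebesgue measurable in \<open>\<tau>\<close>.\<close>

definition freq_measure :: "(real \<times> int \<times> int) measure" where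
  "freq_measure = lebesgue \<Otimes>\<^sub>M (count_space UNIV \<Otimes>\<^sub>M count_space UNIV)"

text \<open>Only meaningful for \<open>\<xi> \<noteq> 0\<close>.\<close>

definition omega :: "int \<Rightarrow> int \<Rightarrow> real" where
  "omega \<xi> \<eta> = (of_int \<xi>) ^ 3 - (of_int \<eta>)\<^sup>2 / of_int \<xi>"

definition square_integrable :: "'a measure \<Rightarrow> ('a \<Rightarrow> complex) \<Rightarrow> bool" where
  "square_integrable M f \<longleftrightarrow>
     f \<in> borel_measurable M \<and> integrable M (\<lambda>x. (cmod (f x))\<^sup>2)"

text \<open>To be read together with \<open>square_integrable M f\<close>: the integral below is \<open>0\<close> by
  convention when \<open>(cmod (f x))\<^sup>2\<close> is not integrable.\<close>

definition L2_norm_on :: "'a measure \<Rightarrow> ('a \<Rightarrow> complex) \<Rightarrow> real" where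
  "L2_norm_on M f = sqrt (\<integral>x. (cmod (f x))\<^sup>2 \<partial>M)"

text \<open>For square-integrable \<open>f\<close> and \<open>g\<close> the integrand is integrable for every \<open>z\<close>, by
  Cauchy-Schwarz and translation and reflection invariance of \<open>freq_measure\<close>.\<close>

definition convolution ::
  "(real \<times> int \<times> int \<Rightarrow> complex) \<Rightarrow> (real \<times> int \<times> int \<Rightarrow> complex) \<Rightarrow> real \<times> int \<times> int \<Rightarrow> complex"
  where "convolution f g z = (\<integral>w. f w * g (z - w) \<partial>freq_measure)"

definition dyadic :: "real set" where
  "dyadic = {2 ^ n | n :: nat. True}"

text \<open>The relations with their constants made explicit: \<open>A \<le> C B\<close>, and \<open>A \<le> C B\<close>
  together with \<open>B \<le> C A\<close>. The relation \<open>A \<lless> B\<close> is \<open>lesssim c A B\<close> with small \<open>c \<in> (0,1)\<close>.\<close>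

definition lesssim :: "real \<Rightarrow> real \<Rightarrow> real \<Rightarrow> bool" where
  "lesssim C A B \<longleftrightarrow> A \<le> C * B"

definition comparable :: "real \<Rightarrow> real \<Rightarrow> real \<Rightarrow> bool" where
  "comparable C A B \<longleftrightarrow> lesssim C A B \<and> lesssim C B A"

end

theory Submission
  imports Defs
begin

text \<open>
  By Cauchy--Schwarz, \<open>\<parallel>f1 * f2\<parallel>\<^sup>2\<close> is at most \<open>\<parallel>f1\<parallel>\<^sup>2 \<parallel>f2\<parallel>\<^sup>2\<close> times the supremum over \<open>(\<tau>, \<xi>, \<eta>)\<close>
  of the measure of the set of decompositions into points of the two supports. Integrating out the
  time frequency leaves a factor \<open>min L1 L2\<close> and the number of lattice points \<open>(m, n) = (\<xi>2, \<eta>2)\<close>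
  with \<open>\<tau> - \<omega>(\<xi> - m, \<eta> - n) - \<omega>(m, n) = O(\<Lambda>)\<close>, \<open>\<Lambda> \<sim> max L1 L2\<close>.

  For fixed \<open>m\<close> the resonance identity turns this into \<open>x\<^sup>2 = A m + O(\<Lambda> / N2)\<close>, where
  \<open>x = \<eta>1/\<xi>1 - \<eta>2/\<xi>2\<close> runs through a progression of step \<open>\<sim> 1/N2\<close>; this has
  \<open>O(1 + min (sqrt (\<Lambda> N2)) (\<Lambda> / sqrt \<bar>A m\<bar>))\<close> solutions. Unless \<open>\<Lambda> \<ge> c N1\<^sup>2 N2\<close>, when counting
  all \<open>m\<close> trivially is enough, the centres \<open>A m\<close> are separated by \<open>N1\<^sup>2 / N2\<close>, and summing
  \<open>1 / sqrt \<bar>A m\<bar>\<close> gives the total \<open>O(N2 + sqrt (\<Lambda> N2) + \<Lambda> N2 / N1)\<close>.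
\<close>

section \<open>Counting resonant frequencies\<close>

lemma card_int_diameter_le:
  fixes S :: "int set" and d :: real
  assumes "d \<ge> 0" and diam: "\<And>s t. s \<in> S \<Longrightarrow> t \<in> S \<Longrightarrow> \<bar>of_int s - of_int t\<bar> \<le> d"
  shows "finite S \<and> real (card S) \<le> 1 + 2 * d"
proof (cases "S = {}")
  case False
  then obtain s where s: "s \<in> S" by auto
  \<comment> \<open>Centring at an arbitrary element gives finiteness at once, at the price of
    \<open>2 * d\<close> in place of \<open>d\<close>.\<close>
  have sub: "S \<subseteq> {s - \<lfloor>d\<rfloor> .. s + \<lfloor>d\<rfloor>}"
  proof
    fix t assume "t \<in> S"
    then have "\<bar>real_of_int (s - t)\<bar> \<le> d" using diam[OF s] by simp
    then have "\<bar>s - t\<bar> \<le> \<lfloor>d\<rfloor>" by (metis le_floor_iff of_int_abs)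
    then show "t \<in> {s - \<lfloor>d\<rfloor> .. s + \<lfloor>d\<rfloor>}" by auto
  qed
  then have "card S \<le> card {s - \<lfloor>d\<rfloor> .. s + \<lfloor>d\<rfloor>}" by (intro card_mono) auto
  also have "\<dots> = nat (1 + 2 * \<lfloor>d\<rfloor>)" by (simp add: algebra_simps)
  finally have "int (card S) \<le> 1 + 2 * \<lfloor>d\<rfloor>" using \<open>d \<ge> 0\<close> zero_le_floor[of d] by linarith
  then have "real (card S) \<le> 1 + 2 * real_of_int \<lfloor>d\<rfloor>" by linarith
  moreover have "real_of_int \<lfloor>d\<rfloor> \<le> d" by (rule of_int_floor_le)
  ultimately have "real (card S) \<le> 1 + 2 * d" by linarith
  then show ?thesis using finite_subset[OF sub] by simp
qed (use \<open>d \<ge> 0\<close> in auto)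

text \<open>Both bounds come from \<open>\<bar>x - y\<bar> * (x + y) \<le> 2 * B\<close>. The first
  replaces \<open>x + y\<close> by the smaller \<open>\<bar>x - y\<bar>\<close> and is uniform in
  \<open>A\<close>; the second replaces it by \<open>sqrt \<bar>A\<bar>\<close>, which is at most
  \<open>x + y\<close> once \<open>\<bar>A\<bar>\<close> exceeds \<open>2 * B\<close>, and it is
  stronger for large \<open>A\<close>.\<close>

lemma square_level_set_gap:
  fixes x y A B :: real
  assumes "x \<ge> 0" "y \<ge> 0" "\<bar>x\<^sup>2 - A\<bar> \<le> B" "\<bar>y\<^sup>2 - A\<bar> \<le> B"
  shows "\<bar>x - y\<bar> \<le> sqrt (2 * B)" and "\<bar>x - y\<bar> * sqrt \<bar>A\<bar> \<le> 2 * B"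
proof -
  have prod: "\<bar>x - y\<bar> * (x + y) \<le> 2 * B"
  proof -
    have "\<bar>x - y\<bar> * (x + y) = \<bar>(x - y) * (x + y)\<bar>" using assms(1,2) by (simp add: abs_mult)
    also have "(x - y) * (x + y) = x\<^sup>2 - y\<^sup>2" by (simp add: algebra_simps power2_eq_square)
    also have "\<bar>\<dots>\<bar> \<le> 2 * B" using assms(3,4) by linarith
    finally show ?thesis .
  qed
  have "\<bar>x - y\<bar>\<^sup>2 \<le> \<bar>x - y\<bar> * (x + y)"
    unfolding power2_eq_square using assms(1,2) by (intro mult_left_mono) auto
  then have "\<bar>x - y\<bar>\<^sup>2 \<le> 2 * B" using prod by linarith
  then show gap: "\<bar>x - y\<bar> \<le> sqrt (2 * B)" by (rule real_le_rsqrt)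
  have B: "B \<ge> 0" using assms(3) by linarith
  show "\<bar>x - y\<bar> * sqrt \<bar>A\<bar> \<le> 2 * B"
  proof (cases "\<bar>A\<bar> \<le> 2 * B")
    case True
    have "\<bar>x - y\<bar> * sqrt \<bar>A\<bar> \<le> sqrt (2 * B) * sqrt (2 * B)"
      using gap True B by (intro mult_mono) auto
    then show ?thesis using B by simp
  next
    case False
    have "A > 0" using False assms(3) zero_le_power2[of x] by linarith
    \<comment> \<open>The sum of squares is at least \<open>2 * (A - B)\<close>, and
      \<open>A > 2 * B\<close> here.\<close>
    have "A \<le> x\<^sup>2 + y\<^sup>2" using False assms(3,4) \<open>A > 0\<close> by linarith
    also have "\<dots> \<le> (x + y)\<^sup>2" using assms(1,2) by (simp add: power2_sum)
    finally have "sqrt \<bar>A\<bar> \<le> x + y" using assms(1,2) \<open>A > 0\<close> by (simp add: real_le_lsqrt)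
    then have "\<bar>x - y\<bar> * sqrt \<bar>A\<bar> \<le> \<bar>x - y\<bar> * (x + y)" by (intro mult_left_mono) auto
    then show ?thesis using prod by linarith
  qed
qed

text \<open>Gap bounds are available for nonnegative arguments only, so the progression is split by
  the sign of its terms, each half having small diameter. The gap \<open>r\<close> stays abstract so
  that either bound on it can be inserted.\<close>

lemma card_progression_near_square_root:
  fixes a b A B r :: real
  assumes "a \<noteq> 0"
    and gap: "\<And>x y. x \<ge> 0 \<Longrightarrow> y \<ge> 0 \<Longrightarrow> \<bar>x\<^sup>2 - A\<bar> \<le> B \<Longrightarrow> \<bar>y\<^sup>2 - A\<bar> \<le> B \<Longrightarrow> \<bar>x - y\<bar> \<le> r"
    and "r \<ge> 0"
  shows "finite {n::int. \<bar>(b - of_int n * a)\<^sup>2 - A\<bar> \<le> B} \<and>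
    real (card {n::int. \<bar>(b - of_int n * a)\<^sup>2 - A\<bar> \<le> B}) \<le> 2 + 4 * (r / \<bar>a\<bar>)"
proof -
  let ?S = "\<lambda>\<sigma>. {n::int. \<bar>(b - of_int n * a)\<^sup>2 - A\<bar> \<le> B \<and> \<sigma> * (b - of_int n * a) \<ge> 0}"
  have part: "finite (?S \<sigma>) \<and> real (card (?S \<sigma>)) \<le> 1 + 2 * (r / \<bar>a\<bar>)" if "\<sigma> \<in> {1, -1}" for \<sigma> :: real
  proof (rule card_int_diameter_le)
    show "r / \<bar>a\<bar> \<ge> 0" using \<open>r \<ge> 0\<close> by simp
    fix s t assume st: "s \<in> ?S \<sigma>" "t \<in> ?S \<sigma>"
    have sq: "(\<sigma> * z)\<^sup>2 = z\<^sup>2" for z using that by auto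
    have "\<bar>\<sigma> * (b - of_int s * a) - \<sigma> * (b - of_int t * a)\<bar> \<le> r"
      using st by (intro gap) (auto simp: sq)
    also have "\<sigma> * (b - of_int s * a) - \<sigma> * (b - of_int t * a) = (- \<sigma>) * ((of_int s - of_int t) * a)"
      by (simp add: algebra_simps)
    also have "\<bar>\<dots>\<bar> = \<bar>of_int s - of_int t\<bar> * \<bar>a\<bar>" using that by (auto simp: abs_mult)
    finally show "\<bar>real_of_int s - of_int t\<bar> \<le> r / \<bar>a\<bar>"
      using \<open>a \<noteq> 0\<close> by (simp add: pos_le_divide_eq)
  qed
  have un: "{n::int. \<bar>(b - of_int n * a)\<^sup>2 - A\<bar> \<le> B} = ?S 1 \<union> ?S (-1)" by auto
  have "card (?S 1 \<union> ?S (-1)) \<le> card (?S 1) + card (?S (-1))" by (rule card_Un_le)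
  then have "real (card (?S 1 \<union> ?S (-1))) \<le> 2 + 4 * (r / \<bar>a\<bar>)"
    using part[of 1] part[of "-1"] by simp
  then show ?thesis unfolding un using part[of 1] part[of "-1"] by simp
qed

lemma card_progression_near_square_root_le:
  fixes a b A B :: real
  assumes "a \<noteq> 0" "B \<ge> 0"
  defines "S \<equiv> {n::int. \<bar>(b - of_int n * a)\<^sup>2 - A\<bar> \<le> B}"
  shows "finite S"
    and "real (card S) \<le> 2 + 4 * (sqrt (2 * B) / \<bar>a\<bar>)"
    and "A \<noteq> 0 \<Longrightarrow> real (card S) \<le> 2 + 4 * (2 * B / sqrt \<bar>A\<bar> / \<bar>a\<bar>)"
proof -
  show "finite S" "real (card S) \<le> 2 + 4 * (sqrt (2 * B) / \<bar>a\<bar>)"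
    using card_progression_near_square_root[OF assms(1) square_level_set_gap(1), where A = A and B = B and b = b] assms(2)
    by (auto simp: S_def)
  show "real (card S) \<le> 2 + 4 * (2 * B / sqrt \<bar>A\<bar> / \<bar>a\<bar>)" if "A \<noteq> 0"
  proof -
    have "\<bar>x - y\<bar> \<le> 2 * B / sqrt \<bar>A\<bar>"
      if "x \<ge> 0" "y \<ge> 0" "\<bar>x\<^sup>2 - A\<bar> \<le> B" "\<bar>y\<^sup>2 - A\<bar> \<le> B" for x y
      using square_level_set_gap(2)[OF that] \<open>A \<noteq> 0\<close> by (simp add: pos_le_divide_eq)
    from card_progression_near_square_root[OF assms(1) this, where b = b] show ?thesis
      using assms(2) by (auto simp: S_def)
  qed
qed

text \<open>The base of the square equals \<open>\<eta>1 / \<xi>1 - \<eta>2 / \<xi>2\<close>. It is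
  written through the total \<open>\<eta>1 + \<eta>2\<close> because, with the total and both
  \<open>\<xi>\<close> fixed, it is then visibly an arithmetic progression in \<open>\<eta>2\<close>
  with step \<open>a\<close>.\<close>

lemma resonance:
  assumes "\<xi>1 \<noteq> 0" "\<xi>2 \<noteq> 0" "\<xi>1 + \<xi>2 \<noteq> 0"
  defines "a \<equiv> of_int (\<xi>1 + \<xi>2) / (of_int \<xi>1 * of_int \<xi>2)"
  shows "a * (omega (\<xi>1 + \<xi>2) (\<eta>1 + \<eta>2) - omega \<xi>1 \<eta>1 - omega \<xi>2 \<eta>2) =
    (of_int (\<eta>1 + \<eta>2) / of_int \<xi>1 - of_int \<eta>2 * a)\<^sup>2 + 3 * (of_int (\<xi>1 + \<xi>2))\<^sup>2"
proof -
  define p q s u v :: real where "p = of_int \<xi>1" and "q = of_int \<xi>2" and "s = p + q" and "u = of_int \<eta>1" and "v = of_int \<eta>2"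
  have nz: "p \<noteq> 0" "q \<noteq> 0" "s \<noteq> 0" using assms(1-3) by (auto simp: p_def q_def s_def simp flip: of_int_add)
  have a: "a = s / (p * q)" by (simp add: a_def p_def q_def s_def)
  have "s / (p * q) * ((s ^ 3 - (u + v)\<^sup>2 / s) - (p ^ 3 - u\<^sup>2 / p) - (q ^ 3 - v\<^sup>2 / q))
      = ((u + v) / p - v * (s / (p * q)))\<^sup>2 + 3 * s\<^sup>2"
    using nz by (simp add: field_simps) (simp add: s_def, algebra)
  then show ?thesis by (simp add: a omega_def p_def q_def s_def u_def v_def)
qed

section \<open>Sums of inverse square roots\<close>

lemma sum_inverse_sqrt_le:
  "(\<Sum>j=1..n. 1 / sqrt (real j)) \<le> 2 * sqrt (real n)"
proof (induction n)
  case (Suc n)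
  \<comment> \<open>Each term is dominated by a telescoping difference, which is seen by
    rationalising it.\<close>
  have "1 / sqrt (real (Suc n)) \<le> 2 * (sqrt (real (Suc n)) - sqrt (real n))"
  proof -
    have s: "(sqrt (real (Suc n)) - sqrt (real n)) * (sqrt (real (Suc n)) + sqrt (real n)) = 1"
      by (simp add: algebra_simps)
    have "1 \<le> (sqrt (real (Suc n)) - sqrt (real n)) * (2 * sqrt (real (Suc n)))"
      by (subst s[symmetric]) (intro mult_left_mono; simp)
    then show ?thesis by (subst pos_divide_le_eq) (auto simp: algebra_simps)
  qed
  then show ?case using Suc by simp
qed simp

text \<open>On either side of \<open>m0\<close> the distances are distinct positive integers up to
  \<open>J\<close>, so each side is dominated by the sum over an initial segment.\<close>

lemma sum_inverse_sqrt_dist_le: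
  fixes M :: "int set" and J :: real
  assumes "finite M" "J \<ge> 0" "\<And>m. m \<in> M \<Longrightarrow> \<bar>of_int (m - m0)\<bar> \<le> J"
  shows "(\<Sum>m \<in> M - {m0}. 1 / sqrt \<bar>of_int (m - m0)\<bar>) \<le> 4 * sqrt J"
proof (cases "M = {}")
  case False
  have J: "J \<ge> 0" by fact
  define k where "k = nat \<lfloor>J\<rfloor>"
  have half: "(\<Sum>m \<in> {m \<in> M. \<sigma> * (m - m0) > 0}. 1 / sqrt \<bar>of_int (m - m0)\<bar>) \<le> 2 * sqrt J"
    if "\<sigma> \<in> {1, -1}" for \<sigma> :: int
  proof -
    let ?P = "{m \<in> M. \<sigma> * (m - m0) > 0}"
    let ?h = "\<lambda>m. nat (\<sigma> * (m - m0))"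
    have inj: "inj_on ?h ?P" using that by (auto simp: inj_on_def)
    have "(\<Sum>m \<in> ?P. 1 / sqrt \<bar>of_int (m - m0)\<bar>) = (\<Sum>m \<in> ?P. 1 / sqrt (real (?h m)))"
      using that by (intro sum.cong) auto
    also have "\<dots> = (\<Sum>j \<in> ?h ` ?P. 1 / sqrt (real j))"
      by (subst sum.reindex[OF inj]) simp
    also have "\<dots> \<le> (\<Sum>j=1..k. 1 / sqrt (real j))"
    proof (intro sum_mono2)
      show "?h ` ?P \<subseteq> {1..k}"
      proof safe
        fix m assume m: "m \<in> M" "\<sigma> * (m - m0) > 0"
        have "\<bar>real_of_int (m - m0)\<bar> \<le> J" using assms(3) m by blast
        then have "\<bar>m - m0\<bar> \<le> \<lfloor>J\<rfloor>" by (metis le_floor_iff of_int_abs)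
        then show "?h m \<in> {1..k}" using that m(2) by (auto simp: k_def)
      qed
    qed auto
    also have "\<dots> \<le> 2 * sqrt (real k)" by (rule sum_inverse_sqrt_le)
    also have "\<dots> \<le> 2 * sqrt J" using J by (simp add: k_def)
    finally show ?thesis .
  qed
  have un: "M - {m0} = {m \<in> M. 1 * (m - m0) > 0} \<union> {m \<in> M. -1 * (m - m0) > 0}" by auto
  have "(\<Sum>m \<in> M - {m0}. 1 / sqrt \<bar>of_int (m - m0)\<bar>) =
      (\<Sum>m \<in> {m \<in> M. 1 * (m - m0) > 0}. 1 / sqrt \<bar>of_int (m - m0)\<bar>)
      + (\<Sum>m \<in> {m \<in> M. -1 * (m - m0) > 0}. 1 / sqrt \<bar>of_int (m - m0)\<bar>)"
    unfolding un using assms(1) by (intro sum.union_disjoint) auto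
  also have "\<dots> \<le> 4 * sqrt J" using half[of 1] half[of "-1"] by simp
  finally show ?thesis .
qed (use assms in \<open>auto\<close>)

text \<open>Here \<open>(\<xi>, \<eta>)\<close> is the output frequency and \<open>(m, n)\<close>
  that of the second factor. The separation hypothesis keeps \<open>\<xi>\<close> and
  \<open>\<xi> - m - m'\<close> of size at least \<open>N1 / K\<close> up to a constant, which
  bounds the step \<open>a m\<close> from below and spreads out the centres
  \<open>A m\<close>.\<close>

lemma card_resonant_set_le:
  fixes K N1 N2 \<Lambda> \<tau> :: real and \<xi> \<eta> :: int
  assumes K: "K \<ge> 1" and N1: "N1 \<ge> 1" and N2: "N2 \<ge> 1" and sep: "8 * K\<^sup>2 * N2 \<le> N1" and L: "\<Lambda> \<ge> 0"
  defines "T \<equiv> {(m, n). N1 / K \<le> \<bar>of_int (\<xi> - m)\<bar> \<and> \<bar>of_int (\<xi> - m)\<bar> \<le> K * N1 \<and>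
     N2 / K \<le> \<bar>of_int m\<bar> \<and> \<bar>of_int m\<bar> \<le> K * N2 \<and>
     \<bar>\<tau> - omega (\<xi> - m) (\<eta> - n) - omega m n\<bar> \<le> \<Lambda>}"
  shows "finite T" and "real (card T) \<le> 128 * K ^ 5 * (N2 + sqrt (\<Lambda> * N2) + \<Lambda> * N2 / N1)"
proof -
  define M where "M = fst ` T"
  define S where "S = (\<lambda>m. {n. (m, n) \<in> T})"
  define a where "a = (\<lambda>m::int. real_of_int \<xi> / (real_of_int (\<xi> - m) * real_of_int m))"
  \<comment> \<open>Up to sign, \<open>R\<close> is the modulation of the output point. Replacing
    \<open>omega \<xi> \<eta>\<close> by \<open>\<tau>\<close> in the resonance identity puts the
    square within \<open>\<bar>a m\<bar> * \<Lambda>\<close> of \<open>A m\<close>.\<close>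
  define R where "R = omega \<xi> \<eta> - \<tau>"
  define A where "A = (\<lambda>m. a m * R - 3 * (real_of_int \<xi>)\<^sup>2)"
  have T: "T = Sigma M S" by (force simp: M_def S_def)
  have pos: "K > 0" "N1 > 0" "N2 > 0" using K N1 N2 by auto
  have KN: "K * N2 \<le> N1 / (8 * K)"
    using sep pos by (simp add: field_simps power2_eq_square)
  have N21: "N2 \<le> N1"
  proof -
    have "1 \<le> 8 * K\<^sup>2" using one_le_power[OF K, of 2] by simp
    then have "1 * N2 \<le> (8 * K\<^sup>2) * N2" using N2 by (intro mult_right_mono) auto
    then show ?thesis using sep by simp
  qed
  have M: "N1 / K \<le> \<bar>real_of_int \<xi> - of_int m\<bar>" "\<bar>real_of_int \<xi> - of_int m\<bar> \<le> K * N1"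
     "N2 / K \<le> \<bar>real_of_int m\<bar>" "\<bar>real_of_int m\<bar> \<le> K * N2" if "m \<in> M" for m
    using that by (auto simp: M_def T_def)
  have nz: "\<xi> - m \<noteq> 0" "m \<noteq> 0" if "m \<in> M" for m
  proof -
    have "0 < N1 / K" "0 < N2 / K" using pos by auto
    then show "\<xi> - m \<noteq> 0" "m \<noteq> 0" using M[OF that] by auto
  qed
  have xi: "7 * N1 / (8 * K) \<le> \<bar>real_of_int \<xi>\<bar>" if "m \<in> M" for m
  proof -
    have "N1 / K - N1 / (8 * K) \<le> \<bar>real_of_int \<xi>\<bar>" using M[OF that] KN by linarith
    moreover have "N1 / K - N1 / (8 * K) = 7 * N1 / (8 * K)" using pos by (simp add: field_simps)
    ultimately show ?thesis by simp
  qed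
  have xi0: "\<xi> \<noteq> 0" if "m \<in> M" for m
  proof -
    have "0 < 7 * N1 / (8 * K)" using pos by simp
    then show ?thesis using xi[OF that] by auto
  qed
  have a0: "a m \<noteq> 0" if "m \<in> M" for m using nz[OF that] xi0[OF that] by (auto simp: a_def)
  have f_le: "\<bar>real_of_int (\<xi> - m) * of_int m\<bar> \<le> K\<^sup>2 * N1 * N2" if "m \<in> M" for m
  proof -
    have "\<bar>real_of_int (\<xi> - m) * of_int m\<bar> \<le> (K * N1) * (K * N2)"
      unfolding abs_mult using M[OF that] pos by (intro mult_mono) auto
    then show ?thesis by (simp add: power2_eq_square mult_ac)
  qed
  have a_ge: "7 / (8 * K ^ 3 * N2) \<le> \<bar>a m\<bar>" if "m \<in> M" for m
  proof -
    have "7 / (8 * K ^ 3 * N2) = (7 * N1 / (8 * K)) / (K\<^sup>2 * N1 * N2)"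
      using pos by (simp add: field_simps power2_eq_square power3_eq_cube)
    also have "\<dots> \<le> \<bar>real_of_int \<xi>\<bar> / \<bar>real_of_int (\<xi> - m) * of_int m\<bar>"
      using f_le[OF that] xi[OF that] nz[OF that] pos by (intro frac_le) (auto simp: abs_mult)
    also have "\<dots> = \<bar>a m\<bar>" by (simp add: a_def)
    finally show ?thesis .
  qed
  have a_le: "\<bar>a m\<bar> \<le> 2 * K / N2" if "m \<in> M" for m
  proof -
    have nzr: "real_of_int \<xi> - of_int m \<noteq> 0" "real_of_int m \<noteq> 0"
      using nz[OF that] by auto
    have "a m = 1 / of_int m + 1 / (of_int \<xi> - of_int m)"
      using nzr by (simp add: a_def field_simps)
    then have "\<bar>a m\<bar> \<le> 1 / \<bar>of_int m\<bar> + 1 / \<bar>of_int \<xi> - of_int m\<bar>"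
      by (metis abs_triangle_ineq abs_divide abs_one)
    also have "\<dots> \<le> 1 / (N2 / K) + 1 / (N1 / K)"
      using M[OF that] nzr pos by (intro add_mono divide_left_mono mult_pos_pos) simp_all
    also have "\<dots> = K / N2 + K / N1" by simp
    also have "K / N1 \<le> K / N2" using N21 pos by (intro divide_left_mono) auto
    finally show ?thesis by simp
  qed
  have S_sub: "S m \<subseteq> {n. \<bar>(of_int \<eta> / of_int (\<xi> - m) - of_int n * a m)\<^sup>2 - A m\<bar> \<le> \<bar>a m\<bar> * \<Lambda>}"
    if m: "m \<in> M" for m
  proof safe
    fix n assume "n \<in> S m"
    then have *: "\<bar>\<tau> - omega (\<xi> - m) (\<eta> - n) - omega m n\<bar> \<le> \<Lambda>" by (auto simp: S_def T_def)
    have "a m * (omega \<xi> \<eta> - omega (\<xi> - m) (\<eta> - n) - omega m n) =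
        (of_int \<eta> / of_int (\<xi> - m) - of_int n * a m)\<^sup>2 + 3 * (of_int \<xi>)\<^sup>2"
      using resonance[of "\<xi> - m" m "\<eta> - n" n] nz[OF m] xi0[OF m] unfolding a_def by simp
    then have "(of_int \<eta> / of_int (\<xi> - m) - of_int n * a m)\<^sup>2 - A m
        = a m * (\<tau> - omega (\<xi> - m) (\<eta> - n) - omega m n)"
      by (simp add: A_def R_def algebra_simps)
    then show "\<bar>(of_int \<eta> / of_int (\<xi> - m) - of_int n * a m)\<^sup>2 - A m\<bar> \<le> \<bar>a m\<bar> * \<Lambda>"
      using * by (simp only: abs_mult mult_left_mono abs_ge_zero)
  qed
  have finS: "finite (S m)" if "m \<in> M" for m
    by (rule finite_subset[OF S_sub[OF that] card_progression_near_square_root_le(1)[OF a0[OF that]]])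
       (use L in simp)
  have Mdist: "\<bar>real_of_int (m - m')\<bar> \<le> 2 * K * N2" if "m \<in> M" "m' \<in> M" for m m'
    using M(4)[OF that(1)] M(4)[OF that(2)] by simp
  have finM: "finite M" and cardM: "real (card M) \<le> 5 * K * N2"
  proof -
    have "finite M \<and> real (card M) \<le> 1 + 2 * (2 * K * N2)"
      using Mdist pos by (intro card_int_diameter_le) auto
    moreover have "1 \<le> K * N2" using mult_mono[of 1 K 1 N2] K N2 by simp
    ultimately show "finite M" "real (card M) \<le> 5 * K * N2" by auto
  qed
  show "finite T" unfolding T using finM finS by (intro finite_SigmaI) auto
  have cardT: "real (card T) = (\<Sum>m\<in>M. real (card (S m)))"
    unfolding T using finM finS by simp
  \<comment> \<open>\<open>2 + Q\<close> bounds every fibre whatever its centre: the uniform gap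
    divided by the step is of order \<open>sqrt (\<Lambda> / \<bar>a m\<bar>)\<close>, so the lower
    bound on the step suffices.\<close>
  define Q where "Q = 8 * K\<^sup>2 * sqrt (\<Lambda> * N2)"
  have S1: "real (card (S m)) \<le> 2 + Q" if m: "m \<in> M" for m
  proof -
    have "real (card (S m)) \<le> 2 + 4 * (sqrt (2 * (\<bar>a m\<bar> * \<Lambda>)) / \<bar>a m\<bar>)"
      using card_mono[OF card_progression_near_square_root_le(1)[OF a0[OF m]] S_sub[OF m]] L
        card_progression_near_square_root_le(2)[OF a0[OF m], of "\<bar>a m\<bar> * \<Lambda>" "of_int \<eta> / of_int (\<xi> - m)" "A m"]
      by force
    also have "sqrt (2 * (\<bar>a m\<bar> * \<Lambda>)) / \<bar>a m\<bar> \<le> 2 * K\<^sup>2 * sqrt (\<Lambda> * N2)"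
    proof -
      have "sqrt (2 * (\<bar>a m\<bar> * \<Lambda>)) / \<bar>a m\<bar> = sqrt (2 * (\<bar>a m\<bar> * \<Lambda>) / (a m)\<^sup>2)"
        by (simp add: real_sqrt_divide)
      also have "2 * (\<bar>a m\<bar> * \<Lambda>) / (a m)\<^sup>2 = 2 * \<Lambda> / \<bar>a m\<bar>"
        using a0[OF m] by (cases "a m > 0") (auto simp: power2_eq_square)
      also have "sqrt \<dots> \<le> sqrt (2 * \<Lambda> / (7 / (8 * K ^ 3 * N2)))"
        using a_ge[OF m] a0[OF m] pos L by (intro real_sqrt_le_mono divide_left_mono mult_pos_pos) auto
      also have "\<dots> \<le> sqrt ((2 * K\<^sup>2)\<^sup>2 * (\<Lambda> * N2))"
      proof (intro real_sqrt_le_mono)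
        have "2 * \<Lambda> / (7 / (8 * K ^ 3 * N2)) = (16 / 7) * (K ^ 3 * (\<Lambda> * N2))" by simp
        also have "\<dots> \<le> 4 * (K ^ 4 * (\<Lambda> * N2))"
          using K L pos by (intro mult_mono power_increasing) auto
        also have "\<dots> = (2 * K\<^sup>2)\<^sup>2 * (\<Lambda> * N2)" by (simp add: power_mult_distrib flip: power_mult)
        finally show "2 * \<Lambda> / (7 / (8 * K ^ 3 * N2)) \<le> (2 * K\<^sup>2)\<^sup>2 * (\<Lambda> * N2)" .
      qed
      also have "\<dots> = 2 * K\<^sup>2 * sqrt (\<Lambda> * N2)"
        unfolding real_sqrt_mult[of "(2 * K\<^sup>2)\<^sup>2"] real_sqrt_abs by simp
      finally show ?thesis .
    qed
    finally show ?thesis by (simp add: Q_def)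
  qed
  have Q0: "Q \<ge> 0" using L pos by (simp add: Q_def)
  have K5: "K ^ 1 \<le> K ^ 5" "K ^ 2 \<le> K ^ 5" using K power_increasing[of 1 5 K] power_increasing[of 2 5 K] by auto
  have sN: "sqrt (\<Lambda> * N2) \<ge> 0" using L pos by simp
  have LN: "\<Lambda> * N2 / N1 \<ge> 0" using L pos by simp
  \<comment> \<open>All cases below aim at this intermediate bound, whose lower powers of
    \<open>K\<close> are absorbed into \<open>K ^ 5\<close>.\<close>
  have final: "real (card T) \<le> 128 * K ^ 5 * (N2 + sqrt (\<Lambda> * N2) + \<Lambda> * N2 / N1)"
    if "real (card T) \<le> 10 * K * N2 + Q + 128 * K ^ 5 * (\<Lambda> * N2 / N1)"
  proof -
    have "10 * K * N2 \<le> 128 * K ^ 5 * N2" using K5 pos by (intro mult_right_mono) auto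
    moreover have "Q \<le> 128 * K ^ 5 * sqrt (\<Lambda> * N2)"
    proof -
      have "8 * K\<^sup>2 \<le> 128 * K ^ 5" using K5 zero_le_power[of K 5] pos by linarith
      then show ?thesis unfolding Q_def using sN by (intro mult_right_mono)
    qed
    ultimately show ?thesis using that by (simp add: algebra_simps)
  qed
  show "real (card T) \<le> 128 * K ^ 5 * (N2 + sqrt (\<Lambda> * N2) + \<Lambda> * N2 / N1)"
  proof (rule final, cases "M = {}")
    case True
    then show "real (card T) \<le> 10 * K * N2 + Q + 128 * K ^ 5 * (\<Lambda> * N2 / N1)"
      unfolding cardT using pos Q0 mult_nonneg_nonneg[OF _ LN, of "128 * K ^ 5"] by simp
  next
    case ne: False
    show "real (card T) \<le> 10 * K * N2 + Q + 128 * K ^ 5 * (\<Lambda> * N2 / N1)"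
    \<comment> \<open>In the first case \<open>sqrt (\<Lambda> * N2)\<close> is
      \<open>O(\<Lambda> / N1)\<close>, so the uniform fibre bound may be summed over all of
      \<open>M\<close>. In the second \<open>\<Lambda>\<close> is too small to hide the resonance,
      and the centres separate.\<close>
    proof (cases "N1\<^sup>2 * N2 \<le> 2 * K ^ 3 * \<Lambda>")
      case True
      have "real (card T) \<le> real (card M) * (2 + Q)"
        unfolding cardT using S1 by (intro sum_bounded_above) auto
      also have "\<dots> \<le> 5 * K * N2 * (2 + Q)" using cardM Q0 by (intro mult_right_mono) auto
      also have "\<dots> = 10 * K * N2 + 40 * K ^ 3 * N2 * sqrt (\<Lambda> * N2)"
        by (simp add: Q_def algebra_simps power2_eq_square power3_eq_cube)
      also have "sqrt (\<Lambda> * N2) \<le> 2 * K ^ 2 * \<Lambda> / N1"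
      proof (rule real_le_lsqrt)
        have "N1\<^sup>2 * (\<Lambda> * N2) = \<Lambda> * (N1\<^sup>2 * N2)" by simp
        also have "\<dots> \<le> \<Lambda> * (2 * K ^ 3 * \<Lambda>)" using True L by (intro mult_left_mono)
        also have "\<dots> \<le> \<Lambda> * (4 * K ^ 4 * \<Lambda>)" using L K by (intro mult_left_mono mult_mono power_increasing) auto
        also have "\<dots> = (2 * K ^ 2 * \<Lambda>)\<^sup>2" by (simp add: power_mult_distrib power2_eq_square flip: power_mult) (simp add: eval_nat_numeral)
        finally show "\<Lambda> * N2 \<le> (2 * K ^ 2 * \<Lambda> / N1)\<^sup>2"
          using pos by (simp add: power_divide pos_le_divide_eq mult_ac)
      qed (use L pos in auto)
      also have "40 * K ^ 3 * N2 * (2 * K ^ 2 * \<Lambda> / N1) = 80 * K ^ 5 * (\<Lambda> * N2 / N1)"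
        by (simp add: eval_nat_numeral)
      also have "\<dots> \<le> Q + 128 * K ^ 5 * (\<Lambda> * N2 / N1)"
        using mult_right_mono[of "80 * K ^ 5" "128 * K ^ 5", OF _ LN] pos Q0 by simp
      finally show ?thesis using pos by simp
    next
      case False
      \<comment> \<open>Since the square is nonnegative, any point of \<open>T\<close> forces
        \<open>3 * \<xi>\<^sup>2\<close> below
        \<open>\<bar>a m\<bar> * (\<bar>R\<bar> + \<Lambda>)\<close>. This gives the factor
        \<open>147 / 128\<close>, of which \<open>\<Lambda>\<close> takes at most
        \<open>1 / 2\<close>.\<close>
      have R_ge: "N1\<^sup>2 * N2 / (2 * K ^ 3) \<le> \<bar>R\<bar>"
      proof -
        obtain m n where mn: "(m, n) \<in> T" using ne by (auto simp: M_def)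
        then have m: "m \<in> M" and "n \<in> S m" by (auto simp: T)
        then have "\<bar>(of_int \<eta> / of_int (\<xi> - m) - of_int n * a m)\<^sup>2 - A m\<bar> \<le> \<bar>a m\<bar> * \<Lambda>"
          using S_sub by blast
        moreover have "0 \<le> (of_int \<eta> / of_int (\<xi> - m) - of_int n * a m)\<^sup>2" by simp
        ultimately have "3 * (real_of_int \<xi>)\<^sup>2 \<le> a m * R + \<bar>a m\<bar> * \<Lambda>" unfolding A_def by linarith
        also have "\<dots> \<le> \<bar>a m\<bar> * (\<bar>R\<bar> + \<Lambda>)" by (simp add: distrib_left flip: abs_mult)
        also have "\<dots> \<le> (2 * K / N2) * (\<bar>R\<bar> + \<Lambda>)" using a_le[OF m] L by (intro mult_right_mono) auto
        finally have 1: "3 * (real_of_int \<xi>)\<^sup>2 \<le> (2 * K / N2) * (\<bar>R\<bar> + \<Lambda>)" .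
        have "(7 * N1 / (8 * K))\<^sup>2 \<le> \<bar>real_of_int \<xi>\<bar>\<^sup>2"
          using xi[OF m] pos by (intro power_mono) auto
        then have "3 * (7 * N1 / (8 * K))\<^sup>2 \<le> (2 * K / N2) * (\<bar>R\<bar> + \<Lambda>)" using 1 by simp
        then have "147 / 128 * (N1\<^sup>2 * N2 / K ^ 3) \<le> \<bar>R\<bar> + \<Lambda>"
          using pos by (simp add: field_simps power2_eq_square power3_eq_cube)
        moreover have "\<Lambda> \<le> 1 / 2 * (N1\<^sup>2 * N2 / K ^ 3)"
          using False pos by (simp add: field_simps)
        moreover have "N1\<^sup>2 * N2 / K ^ 3 \<ge> 0" using pos by simp
        moreover have "N1\<^sup>2 * N2 / (2 * K ^ 3) = 1 / 2 * (N1\<^sup>2 * N2 / K ^ 3)" by simp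
        ultimately show ?thesis by linarith
      qed
      \<comment> \<open>Collecting all bounds separates the centres by \<open>35 / 16 * g\<close>
        per unit of \<open>m\<close>, which is rounded down to \<open>2 * g\<close>.\<close>
      define g where "g = N1\<^sup>2 / (8 * K ^ 9 * N2)"
      have g0: "g > 0" using pos by (simp add: g_def)
      have A_sep: "2 * g * \<bar>of_int (m - m')\<bar> \<le> \<bar>A m - A m'\<bar>" if m: "m \<in> M" "m' \<in> M" for m m'
      proof -
        let ?f = "\<lambda>m. real_of_int (\<xi> - m) * of_int m"
        have fnz: "?f m \<noteq> 0" "?f m' \<noteq> 0" using nz[OF m(1)] nz[OF m(2)] by auto
        have "A m - A m' = R * of_int \<xi> * (1 / ?f m - 1 / ?f m')"
          by (simp add: A_def a_def algebra_simps)
        also have "1 / ?f m - 1 / ?f m' = (?f m' - ?f m) / (?f m * ?f m')"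
        proof -
          have "1 / x - 1 / y = (y - x) / (x * y)" if "x \<noteq> 0" "y \<noteq> 0" for x y :: real
            using that by (simp add: field_simps)
          from this[OF fnz] show ?thesis .
        qed
        \<comment> \<open>The second factor could vanish for general \<open>m\<close> and
          \<open>m'\<close>; with both of size \<open>N2\<close> it cannot, so distinct
          \<open>m\<close> have distinct centres.\<close>
        also have "?f m' - ?f m = of_int (m' - m) * of_int (\<xi> - m - m')"
          by (simp add: algebra_simps)
        finally have eq: "\<bar>A m - A m'\<bar> = \<bar>R\<bar> * \<bar>of_int \<xi>\<bar> * (\<bar>of_int (m - m')\<bar> * \<bar>of_int (\<xi> - m - m')\<bar> / (\<bar>?f m\<bar> * \<bar>?f m'\<bar>))"
          by (simp add: abs_mult abs_minus_commute)
        have x2: "5 * N1 / (8 * K) \<le> \<bar>real_of_int (\<xi> - m - m')\<bar>"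
        proof -
          have "7 * N1 / (8 * K) - 2 * (N1 / (8 * K)) \<le> \<bar>real_of_int (\<xi> - m - m')\<bar>"
            using xi[OF m(1)] M(4)[OF m(1)] M(4)[OF m(2)] KN by simp
          moreover have "7 * N1 / (8 * K) - 2 * (N1 / (8 * K)) = 5 * N1 / (8 * K)"
            using pos by (simp add: field_simps)
          ultimately show ?thesis by simp
        qed
        have "(N1\<^sup>2 * N2 / (2 * K ^ 3)) * (7 * N1 / (8 * K)) * (\<bar>of_int (m - m')\<bar> * (5 * N1 / (8 * K)) / ((K\<^sup>2 * N1 * N2) * (K\<^sup>2 * N1 * N2)))
          \<le> \<bar>A m - A m'\<bar>"
          unfolding eq using R_ge xi[OF m(1)] x2 f_le[OF m(1)] f_le[OF m(2)] fnz pos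
          by (intro mult_mono frac_le mult_pos_pos mult_nonneg_nonneg divide_nonneg_nonneg) auto
        moreover have "(N1\<^sup>2 * N2 / (2 * K ^ 3)) * (7 * N1 / (8 * K)) * (\<bar>of_int (m - m')\<bar> * (5 * N1 / (8 * K)) / ((K\<^sup>2 * N1 * N2) * (K\<^sup>2 * N1 * N2)))
          = 35 / 16 * (g * \<bar>of_int (m - m')\<bar>)"
          using pos by (simp add: g_def field_simps) (simp add: eval_nat_numeral)
        moreover have "g * \<bar>of_int (m - m')\<bar> \<ge> 0" using g0 by simp
        ultimately show ?thesis by linarith
      qed
      \<comment> \<open>Minimality gives
        \<open>\<bar>A m - A m0\<bar> \<le> 2 * \<bar>A m\<bar>\<close>, so the separation turns
        into \<open>\<bar>A m\<bar> \<ge> g * \<bar>m - m0\<bar>\<close>. The fibre over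
        \<open>m0\<close> itself falls under the uniform bound.\<close>
      obtain m0 where m0: "m0 \<in> M" and min: "\<And>m. m \<in> M \<Longrightarrow> \<bar>A m0\<bar> \<le> \<bar>A m\<bar>"
        using arg_min_if_finite[OF finM ne, of "\<lambda>m. \<bar>A m\<bar>"] by (metis not_le)
      have S2: "real (card (S m)) \<le> 2 + 8 * \<Lambda> / sqrt g * (1 / sqrt \<bar>of_int (m - m0)\<bar>)"
        if m: "m \<in> M - {m0}" for m
      proof -
        have mM: "m \<in> M" and ne0: "m \<noteq> m0" using m by auto
        have A_ge: "g * \<bar>of_int (m - m0)\<bar> \<le> \<bar>A m\<bar>"
          using A_sep[OF mM m0] min[OF mM] by linarith
        have p: "0 < g * \<bar>of_int (m - m0)\<bar>" using g0 ne0 by simp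
        then have "A m \<noteq> 0" using A_ge by auto
        have "real (card (S m)) \<le> 2 + 4 * (2 * (\<bar>a m\<bar> * \<Lambda>) / sqrt \<bar>A m\<bar> / \<bar>a m\<bar>)"
          using card_mono[OF card_progression_near_square_root_le(1)[OF a0[OF mM]] S_sub[OF mM]] L
            card_progression_near_square_root_le(3)[OF a0[OF mM] _ \<open>A m \<noteq> 0\<close>, of "\<bar>a m\<bar> * \<Lambda>" "of_int \<eta> / of_int (\<xi> - m)"]
          by force
        also have "\<dots> = 2 + 8 * \<Lambda> / sqrt \<bar>A m\<bar>" using a0[OF mM] by simp
        also have "\<dots> \<le> 2 + 8 * \<Lambda> / sqrt (g * \<bar>of_int (m - m0)\<bar>)"
          using A_ge p L by (intro add_left_mono divide_left_mono mult_pos_pos) auto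
        finally show ?thesis by (simp add: real_sqrt_mult)
      qed
      have "real (card T) = real (card (S m0)) + (\<Sum>m\<in>M - {m0}. real (card (S m)))"
        unfolding cardT by (rule sum.remove[OF finM m0])
      also have "\<dots> \<le> (2 + Q) + (\<Sum>m\<in>M - {m0}. 2 + 8 * \<Lambda> / sqrt g * (1 / sqrt \<bar>of_int (m - m0)\<bar>))"
        using S1[OF m0] S2 by (intro add_mono sum_mono)
      also have "\<dots> = 2 * real (card M) + Q + 8 * \<Lambda> / sqrt g * (\<Sum>m\<in>M - {m0}. 1 / sqrt \<bar>of_int (m - m0)\<bar>)"
      proof -
        have "real (card M) = 1 + real (card (M - {m0}))"
          using finM m0 by (metis card.remove of_nat_Suc)
        then show ?thesis by (simp add: sum.distrib sum_distrib_left)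
      qed
      also have "\<dots> \<le> 2 * (5 * K * N2) + Q + 8 * \<Lambda> / sqrt g * (4 * sqrt (2 * K * N2))"
      proof -
        have "(\<Sum>m\<in>M - {m0}. 1 / sqrt \<bar>of_int (m - m0)\<bar>) \<le> 4 * sqrt (2 * K * N2)"
          using Mdist[OF _ m0] pos by (intro sum_inverse_sqrt_dist_le[OF finM]) auto
        then show ?thesis using cardM L g0 by (intro add_mono mult_left_mono) auto
      qed
      also have "8 * \<Lambda> / sqrt g * (4 * sqrt (2 * K * N2)) = 32 * \<Lambda> * sqrt (2 * K * N2 / g)"
        by (simp add: real_sqrt_divide)
      \<comment> \<open>With this \<open>g\<close> the quotient is a perfect square, and
        \<open>32 * 4\<close> yields the constant \<open>128\<close>.\<close>
      also have "2 * K * N2 / g = (4 * K ^ 5 * N2 / N1)\<^sup>2"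
        using pos by (simp add: g_def power_divide power_mult_distrib field_simps) (simp add: eval_nat_numeral)
      also have "32 * \<Lambda> * sqrt \<dots> = 128 * K ^ 5 * (\<Lambda> * N2 / N1)"
        using pos by (simp add: abs_mult)
      finally show ?thesis by simp
    qed
  qed
qed

section \<open>Convolution bounds in \<open>L\<^sup>2\<close>\<close>

text \<open>Cauchy-Schwarz in \<open>w\<close> against the indicator of the overlap set costs
  \<open>\<kappa>\<close>; Tonelli and translation invariance then integrate out \<open>z\<close>.
  Joint measurability of subtraction is what Tonelli requires.\<close>

lemma convolution_L2_bound:
  fixes M :: "'a::ab_group_add measure" and g1 g2 :: "'a \<Rightarrow> complex" and \<kappa> :: ennreal
  assumes "sigma_finite_measure M"
    and diff[measurable]: "(\<lambda>p. fst p - snd p) \<in> M \<Otimes>\<^sub>M M \<rightarrow>\<^sub>M M"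
    and transl: "\<And>w (h :: 'a \<Rightarrow> ennreal). h \<in> borel_measurable M \<Longrightarrow> (\<integral>\<^sup>+z. h (z - w) \<partial>M) = (\<integral>\<^sup>+z. h z \<partial>M)"
    and space: "space M = UNIV"
    and g[measurable]: "g1 \<in> borel_measurable M" "g2 \<in> borel_measurable M"
    and S[measurable]: "S1 \<in> sets M" "S2 \<in> sets M"
    and supp: "\<And>z. g1 z \<noteq> 0 \<Longrightarrow> z \<in> S1" "\<And>z. g2 z \<noteq> 0 \<Longrightarrow> z \<in> S2"
    and \<kappa>: "\<And>z. emeasure M {w. w \<in> S1 \<and> z - w \<in> S2} \<le> \<kappa>"
  shows "(\<lambda>z. \<integral>w. g1 w * g2 (z - w) \<partial>M) \<in> borel_measurable M"
    and "(\<integral>\<^sup>+z. ennreal ((cmod (\<integral>w. g1 w * g2 (z - w) \<partial>M))\<^sup>2) \<partial>M)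
      \<le> \<kappa> * ((\<integral>\<^sup>+z. ennreal ((cmod (g1 z))\<^sup>2) \<partial>M) * (\<integral>\<^sup>+z. ennreal ((cmod (g2 z))\<^sup>2) \<partial>M))"
proof -
  interpret sigma_finite_measure M by fact
  interpret P: pair_sigma_finite M M ..
  have diff'[measurable]: "(\<lambda>w. z - w) \<in> M \<rightarrow>\<^sub>M M" for z
    using measurable_compose[OF measurable_Pair1' diff, of z] space by simp
  have g2_meas[measurable]: "(\<lambda>p. g2 (fst p - snd p)) \<in> borel_measurable (M \<Otimes>\<^sub>M M)"
    by (rule measurable_compose[OF diff g(2)])
  have g2_meas'[measurable]: "(\<lambda>p. g2 (snd p - fst p)) \<in> borel_measurable (M \<Otimes>\<^sub>M M)"
    using measurable_compose[OF measurable_Pair[OF measurable_snd measurable_fst] g2_meas] by simp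
  show "(\<lambda>z. \<integral>w. g1 w * g2 (z - w) \<partial>M) \<in> borel_measurable M"
    by (rule borel_measurable_lebesgue_integral) (simp add: case_prod_beta')
  let ?I = "\<lambda>z. \<integral>\<^sup>+w. ennreal ((cmod (g1 w))\<^sup>2) * ennreal ((cmod (g2 (z - w)))\<^sup>2) \<partial>M"
  have pointwise: "ennreal ((cmod (\<integral>w. g1 w * g2 (z - w) \<partial>M))\<^sup>2) \<le> \<kappa> * ?I z" for z
  proof -
    let ?E = "{w. w \<in> S1 \<and> z - w \<in> S2}"
    let ?h = "\<lambda>w. ennreal (cmod (g1 w * g2 (z - w)))"
    have E[measurable]: "?E \<in> sets M"
    proof -
      have "?E = S1 \<inter> ((\<lambda>w. z - w) -` S2 \<inter> space M)" using space by auto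
      also have "\<dots> \<in> sets M" using S diff' by (intro sets.Int measurable_sets)
      finally show ?thesis .
    qed
    have hm[measurable]: "?h \<in> borel_measurable M" by measurable
    \<comment> \<open>If the integrand is not integrable, the left side is \<open>0\<close> by
      convention.\<close>
    have "ennreal (cmod (\<integral>w. g1 w * g2 (z - w) \<partial>M)) \<le> (\<integral>\<^sup>+w. ?h w \<partial>M)"
      by (cases "integrable M (\<lambda>w. g1 w * g2 (z - w))")
        (auto simp: integral_norm_bound_ennreal not_integrable_integral_eq)
    also have "\<dots> = (\<integral>\<^sup>+w. indicator ?E w * ?h w \<partial>M)"
      using supp by (intro nn_integral_cong) (auto simp: indicator_def)
    finally have "(ennreal (cmod (\<integral>w. g1 w * g2 (z - w) \<partial>M)))\<^sup>2 \<le> (\<integral>\<^sup>+w. indicator ?E w * ?h w \<partial>M)\<^sup>2"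
      by (rule power_mono) simp
    also have "\<dots> \<le> (\<integral>\<^sup>+w. (indicator ?E w)\<^sup>2 \<partial>M) * (\<integral>\<^sup>+w. (?h w)\<^sup>2 \<partial>M)"
      by (rule Cauchy_Schwarz_nn_integral) auto
    also have "(\<integral>\<^sup>+w. (indicator ?E w)\<^sup>2 \<partial>M) = emeasure M ?E"
      by (subst nn_integral_indicator[symmetric, OF E], intro nn_integral_cong) (auto simp: indicator_def)
    also have "\<dots> \<le> \<kappa>" by (rule \<kappa>)
    also have "(\<integral>\<^sup>+w. (?h w)\<^sup>2 \<partial>M) = ?I z"
      by (intro nn_integral_cong) (simp add: ennreal_power norm_mult power_mult_distrib ennreal_mult)
    finally show ?thesis by (simp add: ennreal_power mult_right_mono)
  qed
  have "(\<integral>\<^sup>+z. ennreal ((cmod (\<integral>w. g1 w * g2 (z - w) \<partial>M))\<^sup>2) \<partial>M) \<le> (\<integral>\<^sup>+z. \<kappa> * ?I z \<partial>M)"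
    by (intro nn_integral_mono pointwise)
  also have "\<dots> = \<kappa> * (\<integral>\<^sup>+z. ?I z \<partial>M)"
    by (intro nn_integral_cmult borel_measurable_nn_integral) (simp add: case_prod_beta')
  also have "(\<integral>\<^sup>+z. ?I z \<partial>M) = (\<integral>\<^sup>+w. \<integral>\<^sup>+z. ennreal ((cmod (g1 w))\<^sup>2) * ennreal ((cmod (g2 (z - w)))\<^sup>2) \<partial>M \<partial>M)"
    by (intro P.Fubini') (simp add: case_prod_beta')
  also have "\<dots> = (\<integral>\<^sup>+w. ennreal ((cmod (g1 w))\<^sup>2) * (\<integral>\<^sup>+z. ennreal ((cmod (g2 z))\<^sup>2) \<partial>M) \<partial>M)"
  proof (intro nn_integral_cong)
    fix w
    have "(\<lambda>z. z - w) \<in> M \<rightarrow>\<^sub>M M"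
      using measurable_compose[OF measurable_Pair2' diff, of w] space by simp
    then have "(\<lambda>z. ennreal ((cmod (g2 (z - w)))\<^sup>2)) \<in> borel_measurable M" by measurable
    then show "(\<integral>\<^sup>+z. ennreal ((cmod (g1 w))\<^sup>2) * ennreal ((cmod (g2 (z - w)))\<^sup>2) \<partial>M)
        = ennreal ((cmod (g1 w))\<^sup>2) * (\<integral>\<^sup>+z. ennreal ((cmod (g2 z))\<^sup>2) \<partial>M)"
      by (subst nn_integral_cmult) (auto simp: transl[where h = "\<lambda>z. ennreal ((cmod (g2 z))\<^sup>2)"])
  qed
  also have "\<dots> = (\<integral>\<^sup>+z. ennreal ((cmod (g1 z))\<^sup>2) \<partial>M) * (\<integral>\<^sup>+z. ennreal ((cmod (g2 z))\<^sup>2) \<partial>M)"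
    by (intro nn_integral_multc) simp
  finally show "(\<integral>\<^sup>+z. ennreal ((cmod (\<integral>w. g1 w * g2 (z - w) \<partial>M))\<^sup>2) \<partial>M)
      \<le> \<kappa> * ((\<integral>\<^sup>+z. ennreal ((cmod (g1 z))\<^sup>2) \<partial>M) * (\<integral>\<^sup>+z. ennreal ((cmod (g2 z))\<^sup>2) \<partial>M))" .
qed

text \<open>Composing a Lebesgue measurable function with \<open>(s, t) \<mapsto> s - t\<close> may destroy measurability for the
  product of the two Lebesgue \<open>\<sigma>\<close>-algebras, so Tonelli is applied to Borel representatives.\<close>

definition freq_borel :: "(real \<times> int \<times> int) measure" where
  "freq_borel = lborel \<Otimes>\<^sub>M count_space UNIV"

section \<open>Borel and Lebesgue versions of the frequency space\<close>

lemma freq_measure_eq: "freq_measure = lebesgue \<Otimes>\<^sub>M count_space UNIV"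
  by (simp add: freq_measure_def pair_measure_countable)

lemma space_freq_borel: "space freq_borel = UNIV"
  by (simp add: freq_borel_def space_pair_measure)

lemma space_freq_measure: "space freq_measure = UNIV"
  by (simp add: freq_measure_eq space_pair_measure)

lemma sigma_finite_count_int_pair: "sigma_finite_measure (count_space (UNIV :: (int \<times> int) set))"
  by (rule sigma_finite_measure_count_space_countable) simp

lemma pair_sigma_finite_freq_borel: "pair_sigma_finite lborel (count_space (UNIV :: (int \<times> int) set))"
  using sigma_finite_count_int_pair by (simp add: pair_sigma_finite_def lborel.sigma_finite_measure_axioms)

lemma sigma_finite_freq_borel: "sigma_finite_measure freq_borel"
  unfolding freq_borel_def
  by (intro sigma_finite_pair_measure lborel.sigma_finite_measure_axioms sigma_finite_count_int_pair)

lemma freq_borel_diff: "(\<lambda>p. fst p - snd p) \<in> freq_borel \<Otimes>\<^sub>M freq_borel \<rightarrow>\<^sub>M freq_borel"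
proof -
  let ?Q = "freq_borel \<Otimes>\<^sub>M freq_borel"
  have [measurable]: "fst \<in> freq_borel \<rightarrow>\<^sub>M borel" "snd \<in> freq_borel \<rightarrow>\<^sub>M count_space UNIV"
    unfolding freq_borel_def by measurable
  have "(\<lambda>p. (snd (fst p), snd (snd p))) \<in> ?Q \<rightarrow>\<^sub>M count_space UNIV \<Otimes>\<^sub>M count_space UNIV"
    by measurable
  \<comment> \<open>By countability the product of the counting spaces carries the full power set,
    so every map out of it is measurable, in particular subtraction.\<close>
  then have "(\<lambda>p. (snd (fst p), snd (snd p))) \<in> ?Q \<rightarrow>\<^sub>M count_space (UNIV :: ((int \<times> int) \<times> (int \<times> int)) set)"
    by (simp add: pair_measure_countable)
  from measurable_compose[OF this measurable_count_space, of "\<lambda>q. fst q - snd q"]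
  have [measurable]: "(\<lambda>p. snd (fst p) - snd (snd p)) \<in> ?Q \<rightarrow>\<^sub>M count_space UNIV" by simp
  have "(\<lambda>p. (fst (fst p) - fst (snd p), snd (fst p) - snd (snd p))) \<in> ?Q \<rightarrow>\<^sub>M borel \<Otimes>\<^sub>M count_space UNIV"
    by measurable
  moreover have "(\<lambda>p. fst p - snd p) = (\<lambda>p. (fst (fst p) - fst (snd p), snd (fst p) - snd (snd p :: real \<times> int \<times> int)))"
    by (auto simp: prod_eq_iff)
  moreover have "sets freq_borel = sets (borel \<Otimes>\<^sub>M count_space UNIV)"
    unfolding freq_borel_def by (intro sets_pair_measure_cong) auto
  ultimately show ?thesis by (simp cong: measurable_cong_sets)
qed

lemma nn_integral_freq_borel:
  assumes "h \<in> borel_measurable freq_borel"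
  shows "(\<integral>\<^sup>+z. h z \<partial>freq_borel) = (\<integral>\<^sup>+k. \<integral>\<^sup>+t. h (t, k) \<partial>lborel \<partial>count_space UNIV)"
  using pair_sigma_finite.nn_integral_snd[OF pair_sigma_finite_freq_borel, of h] assms
  by (simp add: freq_borel_def)

lemma measurable_freq_borel_slice:
  "h \<in> freq_borel \<rightarrow>\<^sub>M N \<Longrightarrow> (\<lambda>t. h (t, k)) \<in> borel \<rightarrow>\<^sub>M N"
  unfolding freq_borel_def using measurable_compose[OF measurable_Pair2'[of k "count_space UNIV" lborel], of h N]
  by simp

lemma freq_borel_translate:
  fixes h :: "real \<times> int \<times> int \<Rightarrow> ennreal"
  assumes [measurable]: "h \<in> borel_measurable freq_borel"
  shows "(\<integral>\<^sup>+z. h (z - w) \<partial>freq_borel) = (\<integral>\<^sup>+z. h z \<partial>freq_borel)"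
proof -
  obtain s l where w: "w = (s, l)" by (cases w)
  have "(\<lambda>z. z - w) \<in> freq_borel \<rightarrow>\<^sub>M freq_borel"
    using measurable_compose[OF measurable_Pair2' freq_borel_diff, of w] by (simp add: space_freq_borel)
  then have "(\<lambda>z. h (z - w)) \<in> borel_measurable freq_borel" by measurable
  have "(\<integral>\<^sup>+z. h (z - w) \<partial>freq_borel) = (\<integral>\<^sup>+k. \<integral>\<^sup>+t. h (-s + 1 * t, k - l) \<partial>lborel \<partial>count_space UNIV)"
    by (subst nn_integral_freq_borel, fact) (simp add: w)
  also have "\<dots> = (\<integral>\<^sup>+k. \<integral>\<^sup>+t. h (t, k - l) \<partial>lborel \<partial>count_space UNIV)"
    using nn_integral_real_affine[OF measurable_freq_borel_slice[OF assms], of 1 _ "-s"]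
    by simp
  also have "\<dots> = (\<integral>\<^sup>+k. \<integral>\<^sup>+t. h (t, k) \<partial>lborel \<partial>count_space UNIV)"
    by (rule nn_integral_bij_count_space[where g = "\<lambda>k. k - l" and f = "\<lambda>k. \<integral>\<^sup>+t. h (t, k) \<partial>lborel"])
       (auto intro!: bij_betwI[where g = "\<lambda>k. k + l"])
  also have "\<dots> = (\<integral>\<^sup>+z. h z \<partial>freq_borel)" by (simp add: nn_integral_freq_borel)
  finally show ?thesis .
qed

text \<open>This lets integrals of Borel functions pass between the two measures without
  change.\<close>

lemma freq_borel_subalgebra:
  "sets freq_borel \<subseteq> sets freq_measure" "space freq_borel = space freq_measure"
  "A \<in> sets freq_borel \<Longrightarrow> emeasure freq_borel A = emeasure freq_measure A"
proof -
  have "(\<lambda>z. z) \<in> lebesgue \<Otimes>\<^sub>M count_space (UNIV :: (int \<times> int) set) \<rightarrow>\<^sub>M lborel \<Otimes>\<^sub>M count_space UNIV"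
  proof -
    have [measurable]: "(\<lambda>z. fst z) \<in> lebesgue \<Otimes>\<^sub>M count_space (UNIV :: (int \<times> int) set) \<rightarrow>\<^sub>M lborel"
      by (rule measurable_compose[OF measurable_fst]) (auto simp: measurable_def)
    have "(\<lambda>z. (fst z, snd z)) \<in> lebesgue \<Otimes>\<^sub>M count_space (UNIV :: (int \<times> int) set) \<rightarrow>\<^sub>M lborel \<Otimes>\<^sub>M count_space UNIV"
      by measurable
    then show ?thesis by simp
  qed
  then show sub: "sets freq_borel \<subseteq> sets freq_measure"
    unfolding freq_borel_def freq_measure_eq by (auto dest: measurable_sets simp: space_pair_measure)
  show "space freq_borel = space freq_measure" by (simp add: space_freq_borel space_freq_measure)
  \<comment> \<open>Slicing at fixed time leaves an outer integral over time, which completion does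
    not affect.\<close>
  show "emeasure freq_borel A = emeasure freq_measure A" if A: "A \<in> sets freq_borel"
    using A sub sigma_finite_measure.emeasure_pair_measure_alt[OF sigma_finite_count_int_pair, of A]
    by (auto simp: freq_borel_def freq_measure_eq nn_integral_completion)
qed

text \<open>Each integer slice is almost everywhere equal to a Borel function. There are countably
  many slices, so a single null set \<open>N\<close> of times serves them all.\<close>

lemma freq_measure_ex_borel:
  fixes f :: "real \<times> int \<times> int \<Rightarrow> complex"
  assumes f: "f \<in> borel_measurable freq_measure"
  obtains g N where "g \<in> borel_measurable freq_borel" "N \<in> null_sets lborel" "\<And>t k. t \<notin> N \<Longrightarrow> f (t, k) = g (t, k)"
proof -
  have slice: "(\<lambda>t. f (t, k)) \<in> borel_measurable lebesgue" for k
    using measurable_compose[OF measurable_Pair2'[of k "count_space UNIV" lebesgue], of f borel] f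
    by (simp add: freq_measure_eq)
  have "\<exists>g\<in>borel_measurable lborel. AE t in lborel. f (t, k) = g t" for k
  proof -
    obtain u where [measurable]: "u \<in> borel_measurable lborel" and u: "AE t in lborel. Re (f (t, k)) = u t"
      using completion_ex_borel_measurable_real[OF measurable_compose[OF slice borel_measurable_Re]] by blast
    obtain v where [measurable]: "v \<in> borel_measurable lborel" and v: "AE t in lborel. Im (f (t, k)) = v t"
      using completion_ex_borel_measurable_real[OF measurable_compose[OF slice borel_measurable_Im]] by blast
    from u v have "AE t in lborel. f (t, k) = of_real (u t) + \<i> * of_real (v t)"
      by eventually_elim (simp add: complex_eq_iff)
    then show ?thesis by (intro bexI[of _ "\<lambda>t. of_real (u t) + \<i> * of_real (v t)"]) auto
  qed
  then obtain g where g[measurable]: "\<And>k. g k \<in> borel_measurable lborel"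
    and ae: "\<And>k. AE t in lborel. f (t, k) = g k t" by metis
  have "AE t in lborel. \<forall>k. f (t, k) = g k t" using ae by (simp add: AE_all_countable)
  then obtain N where N: "N \<in> null_sets lborel" "\<And>t. t \<notin> N \<Longrightarrow> \<forall>k. f (t, k) = g k t"
    by (auto simp: eventually_ae_filter)
  have "(\<lambda>z. g (snd z) (fst z)) \<in> borel_measurable freq_borel"
    unfolding freq_borel_def
    by (rule measurable_compose_countable[where f = "\<lambda>k z. g k (fst z)" and g = snd]) measurable
  with N show ?thesis by (intro that[of "\<lambda>z. g (snd z) (fst z)" N]) auto
qed

lemma null_sets_freq_measure_strip:
  assumes "N \<in> null_sets lborel"
  shows "AE z in freq_measure. fst z \<notin> N"
proof -
  have "N \<times> UNIV \<in> null_sets freq_measure"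
    unfolding freq_measure_eq using assms
    by (intro sigma_finite_measure.times_in_null_sets1[OF sigma_finite_count_int_pair])
       (auto intro: null_sets_completionI)
  then show ?thesis by (rule AE_I') auto
qed

text \<open>Keeps the exceptional times of the second factor null under the substitution
  \<open>z - w\<close> in the convolution.\<close>

lemma null_sets_lborel_reflect:
  fixes s :: real
  assumes "N \<in> null_sets lborel"
  shows "{t. s - t \<in> N} \<in> null_sets lborel"
proof -
  have N[measurable]: "N \<in> sets borel" using assms by auto
  have "emeasure lborel N = (\<integral>\<^sup>+t. indicator N (s + (-1) * t) \<partial>lborel)"
    using nn_integral_real_affine[of "indicator N" "-1" s] by simp
  also have "\<dots> = (\<integral>\<^sup>+t. indicator {t. s - t \<in> N} t \<partial>lborel)"
    by (intro nn_integral_cong) (simp add: indicator_def)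
  also have "\<dots> = emeasure lborel {t. s - t \<in> N}" by (intro nn_integral_indicator) measurable
  finally show ?thesis using assms by (simp add: null_sets_def)
qed

text \<open>For fixed \<open>z\<close> the map is affine in time, and affine maps respect Lebesgue
  measurability. This suffices for comparing integrands at a single \<open>z\<close>.\<close>

lemma freq_measure_reflect: "(\<lambda>w. z - w) \<in> freq_measure \<rightarrow>\<^sub>M freq_measure"
proof -
  obtain s l where z: "z = (s, l)" by (cases z)
  have "(\<lambda>t::real. s + (-1) * t) \<in> lebesgue \<rightarrow>\<^sub>M lebesgue"
    using lebesgue_affine_measurable[of "\<lambda>_::real. -1" s] by simp
  from measurable_compose[OF measurable_fst this]
  have [measurable]: "(\<lambda>w. s - fst w) \<in> lebesgue \<Otimes>\<^sub>M count_space (UNIV :: (int \<times> int) set) \<rightarrow>\<^sub>M lebesgue"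
    by simp
  have [measurable]: "(\<lambda>w. l - snd w) \<in> lebesgue \<Otimes>\<^sub>M count_space (UNIV :: (int \<times> int) set) \<rightarrow>\<^sub>M count_space UNIV"
    by (rule measurable_compose[OF measurable_snd]) simp
  have "(\<lambda>w. (s - fst w, l - snd w)) \<in> lebesgue \<Otimes>\<^sub>M count_space (UNIV :: (int \<times> int) set) \<rightarrow>\<^sub>M lebesgue \<Otimes>\<^sub>M count_space UNIV"
    by measurable
  moreover have "(\<lambda>w. z - w) = (\<lambda>w. (s - fst w, l - snd w))" by (auto simp: z prod_eq_iff)
  ultimately show ?thesis by (simp add: freq_measure_eq)
qed

text \<open>Borel representatives leave the convolution unchanged at every \<open>z\<close>, not
  just almost everywhere, because the exceptional strips are null in \<open>w\<close> for each
  \<open>z\<close>. The abstract bound then applies to the representatives.\<close>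

lemma convolution_freq_L2_bound:
  fixes f1 f2 :: "real \<times> int \<times> int \<Rightarrow> complex" and \<kappa> :: ennreal
  assumes f[measurable]: "f1 \<in> borel_measurable freq_measure" "f2 \<in> borel_measurable freq_measure"
    and S[measurable]: "S1 \<in> sets freq_borel" "S2 \<in> sets freq_borel"
    and supp: "\<And>z. f1 z \<noteq> 0 \<Longrightarrow> z \<in> S1" "\<And>z. f2 z \<noteq> 0 \<Longrightarrow> z \<in> S2"
    and \<kappa>: "\<And>z. emeasure freq_borel {w. w \<in> S1 \<and> z - w \<in> S2} \<le> \<kappa>"
  shows "convolution f1 f2 \<in> borel_measurable freq_measure"
    and "(\<integral>\<^sup>+z. ennreal ((cmod (convolution f1 f2 z))\<^sup>2) \<partial>freq_measure)
      \<le> \<kappa> * ((\<integral>\<^sup>+z. ennreal ((cmod (f1 z))\<^sup>2) \<partial>freq_measure) * (\<integral>\<^sup>+z. ennreal ((cmod (f2 z))\<^sup>2) \<partial>freq_measure))"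
proof -
  have ex: "\<exists>g N. g \<in> borel_measurable freq_borel \<and> N \<in> null_sets lborel \<and>
      (\<forall>t k. t \<notin> N \<longrightarrow> f (t, k) = g (t, k)) \<and> (\<forall>z. g z \<noteq> 0 \<longrightarrow> z \<in> S)"
    if fm: "f \<in> borel_measurable freq_measure" and Sm[measurable]: "S \<in> sets freq_borel"
      and fS: "\<And>z. f z \<noteq> 0 \<Longrightarrow> z \<in> S" for f :: "real \<times> int \<times> int \<Rightarrow> complex" and S
  proof -
    obtain g N where g[measurable]: "g \<in> borel_measurable freq_borel" and N: "N \<in> null_sets lborel"
      "\<And>t k. t \<notin> N \<Longrightarrow> f (t, k) = g (t, k)" using freq_measure_ex_borel[OF fm] by blast
    \<comment> \<open>A representative may leave \<open>S\<close> over the null set of times;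
      truncation restores the support without affecting agreement elsewhere.\<close>
    have "(\<lambda>z. indicator S z *\<^sub>R g z) \<in> borel_measurable freq_borel" by measurable
    moreover have "\<forall>t k. t \<notin> N \<longrightarrow> f (t, k) = indicator S (t, k) *\<^sub>R g (t, k)"
    proof (intro allI impI)
      fix t k assume "t \<notin> N"
      then show "f (t, k) = indicator S (t, k) *\<^sub>R g (t, k)"
        using N(2)[of t k] fS[of "(t, k)"] by (cases "(t, k) \<in> S") auto
    qed
    moreover have "\<forall>z. indicator S z *\<^sub>R g z \<noteq> 0 \<longrightarrow> z \<in> S" by (auto simp: indicator_def)
    ultimately show ?thesis using N(1) by blast
  qed
  obtain g1 N1 where g1: "g1 \<in> borel_measurable freq_borel" "N1 \<in> null_sets lborel"
      "\<And>t k. t \<notin> N1 \<Longrightarrow> f1 (t, k) = g1 (t, k)" "\<And>z. g1 z \<noteq> 0 \<Longrightarrow> z \<in> S1"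
    using ex[OF f(1) S(1) supp(1)] by blast
  obtain g2 N2 where g2: "g2 \<in> borel_measurable freq_borel" "N2 \<in> null_sets lborel"
      "\<And>t k. t \<notin> N2 \<Longrightarrow> f2 (t, k) = g2 (t, k)" "\<And>z. g2 z \<noteq> 0 \<Longrightarrow> z \<in> S2"
    using ex[OF f(2) S(2) supp(2)] by blast
  note sub = freq_borel_subalgebra
  have lift: "h \<in> borel_measurable freq_measure" if "h \<in> borel_measurable freq_borel"
    for h :: "real \<times> int \<times> int \<Rightarrow> complex"
    using that sub(1,2) by (auto simp: measurable_def)
  have conv: "convolution f1 f2 z = (\<integral>w. g1 w * g2 (z - w) \<partial>freq_borel)" for z
  proof -
    have refl: "(\<lambda>w. z - w) \<in> freq_borel \<rightarrow>\<^sub>M freq_borel"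
      using measurable_compose[OF measurable_Pair1' freq_borel_diff, of z] by (simp add: space_freq_borel)
    have "convolution f1 f2 z = (\<integral>w. g1 w * g2 (z - w) \<partial>freq_measure)"
      unfolding convolution_def
    proof (rule integral_cong_AE)
      have "AE w in freq_measure. fst w \<notin> {t. fst z - t \<in> N2}"
        by (intro null_sets_freq_measure_strip null_sets_lborel_reflect g2)
      with null_sets_freq_measure_strip[OF g1(2)]
      show "AE w in freq_measure. f1 w * f2 (z - w) = g1 w * g2 (z - w)"
      proof eventually_elim
        case (elim w)
        have "f1 w = g1 w" using elim g1(3)[of "fst w" "snd w"] by simp
        moreover have "f2 (z - w) = g2 (z - w)"
          using g2(3)[of "fst (z - w)" "snd (z - w)"] elim unfolding prod.collapse by simp
        ultimately show ?case by simp
      qed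
    qed (intro borel_measurable_times measurable_compose[OF freq_measure_reflect] f lift g1(1) g2(1))+
    also have "\<dots> = (\<integral>w. g1 w * g2 (z - w) \<partial>freq_borel)"
      using measurable_compose[OF refl g2(1)] g1(1)
      by (intro integral_subalgebra[symmetric] sub borel_measurable_times)
    finally show ?thesis .
  qed
  note bound = convolution_L2_bound[OF sigma_finite_freq_borel freq_borel_diff freq_borel_translate
      space_freq_borel g1(1) g2(1) S g1(4) g2(4) \<kappa>]
  have conv_meas: "convolution f1 f2 \<in> borel_measurable freq_borel"
    using bound(1) by (simp add: conv[abs_def])
  show "convolution f1 f2 \<in> borel_measurable freq_measure" by (rule lift[OF conv_meas])
  have tr: "(\<integral>\<^sup>+z. ennreal ((cmod (h z))\<^sup>2) \<partial>freq_borel) = (\<integral>\<^sup>+z. ennreal ((cmod (h z))\<^sup>2) \<partial>freq_measure)"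
    if [measurable]: "h \<in> borel_measurable freq_borel" for h :: "real \<times> int \<times> int \<Rightarrow> complex"
    by (intro nn_integral_subalgebra sub) measurable
  have e1: "(\<integral>\<^sup>+z. ennreal ((cmod (f1 z))\<^sup>2) \<partial>freq_measure) = (\<integral>\<^sup>+z. ennreal ((cmod (g1 z))\<^sup>2) \<partial>freq_measure)"
    by (rule nn_integral_cong_AE, rule AE_mp[OF null_sets_freq_measure_strip[OF g1(2)]])
       (use g1(3) in \<open>auto intro!: AE_I2\<close>)
  have e2: "(\<integral>\<^sup>+z. ennreal ((cmod (f2 z))\<^sup>2) \<partial>freq_measure) = (\<integral>\<^sup>+z. ennreal ((cmod (g2 z))\<^sup>2) \<partial>freq_measure)"
    by (rule nn_integral_cong_AE, rule AE_mp[OF null_sets_freq_measure_strip[OF g2(2)]])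
       (use g2(3) in \<open>auto intro!: AE_I2\<close>)
  show "(\<integral>\<^sup>+z. ennreal ((cmod (convolution f1 f2 z))\<^sup>2) \<partial>freq_measure)
      \<le> \<kappa> * ((\<integral>\<^sup>+z. ennreal ((cmod (f1 z))\<^sup>2) \<partial>freq_measure) * (\<integral>\<^sup>+z. ennreal ((cmod (f2 z))\<^sup>2) \<partial>freq_measure))"
    unfolding e1 e2 tr[OF g1(1), symmetric] tr[OF g2(1), symmetric] tr[OF conv_meas, symmetric]
    unfolding conv by (rule bound(2))
qed

section \<open>The bilinear estimate\<close>

definition slab :: "real \<Rightarrow> real \<Rightarrow> real \<Rightarrow> (real \<times> int \<times> int) set" where
  "slab K N L = {(\<tau>, \<xi>, \<eta>). N / K \<le> \<bar>of_int \<xi>\<bar> \<and> \<bar>of_int \<xi>\<bar> \<le> K * N \<and> \<bar>\<tau> - omega \<xi> \<eta>\<bar> \<le> K * L}"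

lemma sets_slab: "slab K N L \<in> sets freq_borel"
proof -
  let ?p = "\<lambda>k :: int \<times> int. N / K \<le> \<bar>of_int (fst k)\<bar> \<and> \<bar>of_int (fst k)\<bar> \<le> K * N"
  have [measurable]: "fst \<in> freq_borel \<rightarrow>\<^sub>M borel" "snd \<in> freq_borel \<rightarrow>\<^sub>M count_space UNIV"
    unfolding freq_borel_def by measurable
  have [measurable]: "(\<lambda>z. case snd z of (\<xi>, \<eta>) \<Rightarrow> omega \<xi> \<eta>) \<in> borel_measurable freq_borel"
    by (rule measurable_compose[of snd freq_borel "count_space UNIV"]) simp_all
  have [measurable]: "Measurable.pred freq_borel (\<lambda>z. ?p (snd z))"
    by (rule measurable_compose[of snd freq_borel "count_space UNIV"]) simp_all
  have "{z \<in> space freq_borel. ?p (snd z) \<and> \<bar>fst z - (case snd z of (\<xi>, \<eta>) \<Rightarrow> omega \<xi> \<eta>)\<bar> \<le> K * L} \<in> sets freq_borel"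
    by measurable
  also have "{z \<in> space freq_borel. ?p (snd z) \<and> \<bar>fst z - (case snd z of (\<xi>, \<eta>) \<Rightarrow> omega \<xi> \<eta>)\<bar> \<le> K * L} = slab K N L"
    by (auto simp: slab_def space_freq_borel)
  finally show ?thesis .
qed

text \<open>For each frequency the admissible times lie in two intervals, one per slab, and the
  shorter gives the minimum. Eliminating time by the triangle inequality leaves the resonance
  condition with tolerance \<open>\<Lambda>\<close>, so the lattice count applies.\<close>

lemma emeasure_slab_overlap_le:
  fixes K N1 N2 L1 L2 :: real
  assumes K: "K \<ge> 1" and N: "N1 \<ge> 1" "N2 \<ge> 1" "8 * K\<^sup>2 * N2 \<le> N1" and L: "L1 \<ge> 0" "L2 \<ge> 0"
  defines "\<Lambda> \<equiv> 2 * K * max L1 L2"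
  shows "emeasure freq_borel {w. w \<in> slab K N1 L1 \<and> z - w \<in> slab K N2 L2}
    \<le> ennreal (2 * K * min L1 L2 * (128 * K ^ 5 * (N2 + sqrt (\<Lambda> * N2) + \<Lambda> * N2 / N1)))"
proof -
  obtain \<tau> \<xi> \<eta> where z: "z = (\<tau>, \<xi>, \<eta>)" by (cases z)
  let ?E = "{w. w \<in> slab K N1 L1 \<and> z - w \<in> slab K N2 L2}"
  define T where "T = {(m, n). N1 / K \<le> \<bar>of_int (\<xi> - m)\<bar> \<and> \<bar>of_int (\<xi> - m)\<bar> \<le> K * N1 \<and>
     N2 / K \<le> \<bar>of_int m\<bar> \<and> \<bar>of_int m\<bar> \<le> K * N2 \<and>
     \<bar>\<tau> - omega (\<xi> - m) (\<eta> - n) - omega m n\<bar> \<le> \<Lambda>}"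
  \<comment> \<open>\<open>T\<close> records the frequency of the second factor, whereas the slices
    are indexed by that of the first.\<close>
  define T' where "T' = (\<lambda>k. (\<xi>, \<eta>) - k) ` T"
  have \<Lambda>: "\<Lambda> \<ge> 0" using K L by (simp add: \<Lambda>_def)
  note card = card_resonant_set_le[OF K N \<Lambda>, of \<xi> \<tau> \<eta>, folded T_def]
  have finT': "finite T'" and cardT': "card T' \<le> card T"
    using card(1) by (auto simp: T'_def card_image_le)
  have E: "?E \<in> sets freq_borel"
  proof -
    have refl: "(\<lambda>w. z - w) \<in> freq_borel \<rightarrow>\<^sub>M freq_borel"
      using measurable_compose[OF measurable_Pair1' freq_borel_diff, of z] by (simp add: space_freq_borel)
    have "?E = slab K N1 L1 \<inter> ((\<lambda>w. z - w) -` slab K N2 L2 \<inter> space freq_borel)"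
      by (auto simp: space_freq_borel)
    also have "\<dots> \<in> sets freq_borel" using sets_slab refl by (intro sets.Int measurable_sets)
    finally show ?thesis .
  qed
  have slice: "emeasure lborel ((\<lambda>t. (t, k)) -` ?E) \<le> ennreal (2 * K * min L1 L2) * indicator T' k" for k
  proof (cases "(\<lambda>t. (t, k)) -` ?E = {}")
    case False
    obtain a b where k: "k = (a, b)" by (cases k)
    have sub: "(\<lambda>t. (t, k)) -` ?E \<subseteq> {omega a b - K * L1 .. omega a b + K * L1}"
       "(\<lambda>t. (t, k)) -` ?E \<subseteq> {\<tau> - omega (\<xi> - a) (\<eta> - b) - K * L2 .. \<tau> - omega (\<xi> - a) (\<eta> - b) + K * L2}"
      by (auto simp: k z slab_def abs_le_iff)
    have "emeasure lborel ((\<lambda>t. (t, k)) -` ?E) \<le> ennreal (2 * K * L1)"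
      using emeasure_mono[OF sub(1), of lborel] K L by (simp add: mult.assoc)
    moreover have "emeasure lborel ((\<lambda>t. (t, k)) -` ?E) \<le> ennreal (2 * K * L2)"
      using emeasure_mono[OF sub(2), of lborel] K L by (simp add: mult.assoc)
    ultimately have "emeasure lborel ((\<lambda>t. (t, k)) -` ?E) \<le> ennreal (2 * K * min L1 L2)"
      by (simp add: min_def)
    moreover have "k \<in> T'"
    proof -
      obtain t where t: "(t, k) \<in> ?E" using False by auto
      have s: "\<bar>t - omega a b\<bar> \<le> K * L1" "\<bar>\<tau> - t - omega (\<xi> - a) (\<eta> - b)\<bar> \<le> K * L2"
        using t by (auto simp: k z slab_def)
      have "K * L1 \<le> K * max L1 L2" "K * L2 \<le> K * max L1 L2"
        using K by (auto intro!: mult_left_mono)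
      then have "\<bar>\<tau> - omega a b - omega (\<xi> - a) (\<eta> - b)\<bar> \<le> \<Lambda>"
        using s unfolding \<Lambda>_def by linarith
      then have "(\<xi> - a, \<eta> - b) \<in> T" using t by (auto simp: T_def k z slab_def)
      then show ?thesis unfolding T'_def k by (force intro: rev_image_eqI)
    qed
    ultimately show ?thesis by simp
  next
    case True
    then show ?thesis by (simp only: emeasure_empty zero_le)
  qed
  have "emeasure freq_borel ?E = (\<integral>\<^sup>+k. emeasure lborel ((\<lambda>t. (t, k)) -` ?E) \<partial>count_space UNIV)"
    using E unfolding freq_borel_def
    by (rule pair_sigma_finite.emeasure_pair_measure_alt2[OF pair_sigma_finite_freq_borel])
  also have "\<dots> \<le> (\<integral>\<^sup>+k. ennreal (2 * K * min L1 L2) * indicator T' k \<partial>count_space UNIV)"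
    by (intro nn_integral_mono slice)
  also have "\<dots> = ennreal (2 * K * min L1 L2) * of_nat (card T')"
    using finT' by (subst nn_integral_cmult_indicator) auto
  also have "\<dots> = ennreal (2 * K * min L1 L2 * real (card T'))"
    using K L by (simp add: ennreal_mult ennreal_of_nat_eq_real_of_nat)
  also have "\<dots> \<le> ennreal (2 * K * min L1 L2 * (128 * K ^ 5 * (N2 + sqrt (\<Lambda> * N2) + \<Lambda> * N2 / N1)))"
    using cardT' card(2) K L by (intro ennreal_leI mult_left_mono) auto
  finally show ?thesis .
qed

text \<open>With \<open>u = N1 powr (- \<alpha>)\<close> the hypotheses say
  \<open>L * u \<ge> 1\<close> and \<open>1 / N1 \<le> u\<close>. The first handles the terms
  \<open>N2\<close> and \<open>sqrt (2 * K * L * N2)\<close>, the second the last term.\<close>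

lemma count_le_weight:
  fixes K N1 N2 L \<alpha> :: real
  assumes K: "K \<ge> 1" and N: "N1 \<ge> 1" "N2 \<ge> 1" and \<alpha>: "\<alpha> \<le> 1" and L: "N1 powr \<alpha> \<le> L"
  shows "N2 + sqrt (2 * K * L * N2) + 2 * K * L * N2 / N1
    \<le> 3 * K * L * (N2 powr (1/2) * N1 powr (- \<alpha>/2) + N2 powr (1/4) * N1 powr (- \<alpha>/4))\<^sup>2"
proof -
  define P where "P = N2 powr (1/2) * N1 powr (- \<alpha>/2)"
  define Q where "Q = N2 powr (1/4) * N1 powr (- \<alpha>/4)"
  define u where "u = N1 powr (- \<alpha>)"
  have Lpos: "L > 0" using L N powr_gt_zero[of N1 \<alpha>] by linarith
  have u: "u > 0" "1 \<le> L * u" "1 / N1 \<le> u"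
  proof -
    show "u > 0" using N by (simp add: u_def)
    have "1 = N1 powr \<alpha> * u" using N by (simp add: u_def flip: powr_add)
    also have "\<dots> \<le> L * u" using L \<open>u > 0\<close> by (intro mult_right_mono) auto
    finally show "1 \<le> L * u" .
    have "1 / N1 = N1 powr (-1)" using N by (simp add: powr_minus_divide)
    also have "\<dots> \<le> u" unfolding u_def using N \<alpha> by (intro powr_mono) auto
    finally show "1 / N1 \<le> u" .
  qed
  have sq: "(x powr a)\<^sup>2 = x powr (2 * a)" for x a :: real
    by (simp add: power2_eq_square flip: powr_add)
  have P2: "P\<^sup>2 = N2 * u" using N by (simp add: P_def u_def power_mult_distrib sq)
  have Q2: "Q\<^sup>2 = sqrt (N2 * u)"
  proof -
    have "Q\<^sup>2 = P" using N by (simp add: Q_def P_def power_mult_distrib sq)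
    moreover have "P \<ge> 0" by (simp add: P_def)
    ultimately show ?thesis by (simp flip: P2)
  qed
  have s1: "N2 \<le> K * L * P\<^sup>2"
  proof -
    have "1 * N2 \<le> (L * u) * N2" using u N by (intro mult_right_mono) auto
    also have "\<dots> \<le> K * ((L * u) * N2)" using K u N Lpos mult_right_mono[of 1 K "(L * u) * N2"] by simp
    finally show ?thesis by (simp add: P2 mult_ac)
  qed
  have s2: "sqrt (2 * K * L * N2) \<le> 2 * K * L * Q\<^sup>2"
  proof -
    have "2 * K * L * N2 \<le> (2 * K) * (2 * K) * (L * L) * (N2 * u)"
    proof -
      have "2 * K * (L * N2) * 1 \<le> 2 * K * (L * N2) * (2 * K * (L * u))"
        using K u Lpos N mult_mono[of 1 "2 * K" 1 "L * u"] by (intro mult_left_mono) auto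
      then show ?thesis by (simp add: mult_ac)
    qed
    then have "sqrt (2 * K * L * N2) \<le> sqrt ((2 * K) * (2 * K) * (L * L) * (N2 * u))" by simp
    also have "\<dots> = 2 * K * L * Q\<^sup>2" using K Lpos unfolding Q2 by (simp add: real_sqrt_mult)
    finally show ?thesis .
  qed
  have s3: "2 * K * L * N2 / N1 \<le> 2 * K * L * P\<^sup>2"
    using mult_left_mono[OF u(3), of "2 * K * L * N2"] K Lpos N by (simp add: P2 mult_ac)
  have "P * Q \<ge> 0" by (simp add: P_def Q_def)
  \<comment> \<open>The three terms add up to at most
    \<open>K * L * (3 * P\<^sup>2 + 2 * Q\<^sup>2)\<close>.\<close>
  then have "3 * K * L * (P\<^sup>2 + Q\<^sup>2) \<le> 3 * K * L * (P + Q)\<^sup>2"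
    using K Lpos by (intro mult_left_mono) (auto simp: power2_sum)
  moreover have "K * L * Q\<^sup>2 \<ge> 0" using K Lpos by simp
  ultimately show ?thesis using s1 s2 s3 unfolding P_def[symmetric] Q_def[symmetric]
    by (simp add: algebra_simps)
qed

section \<open>From square integrals to norms\<close>

lemma square_integrable_nn_integral:
  assumes "square_integrable M f"
  shows "(\<integral>\<^sup>+z. ennreal ((cmod (f z))\<^sup>2) \<partial>M) = ennreal ((L2_norm_on M f)\<^sup>2)"
  using assms by (simp add: square_integrable_def L2_norm_on_def nn_integral_eq_integral)

lemma L2_norm_on_nonneg: "L2_norm_on M f \<ge> 0"
  by (simp add: L2_norm_on_def)

text \<open>Integrability is derived along with the bound, since \<open>L2_norm_on\<close> is
  \<open>0\<close> by convention without it.\<close>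

lemma square_integrable_L2_norm_le:
  assumes f: "f \<in> borel_measurable M" and "B \<ge> 0"
    and le: "(\<integral>\<^sup>+z. ennreal ((cmod (f z))\<^sup>2) \<partial>M) \<le> ennreal (B\<^sup>2)"
  shows "square_integrable M f" and "L2_norm_on M f \<le> B"
proof -
  have fin: "(\<integral>\<^sup>+z. ennreal ((cmod (f z))\<^sup>2) \<partial>M) < \<infinity>"
    using le ennreal_less_top order.strict_trans1 by (metis infinity_ennreal_def)
  have "integrable M (\<lambda>z. (cmod (f z))\<^sup>2)"
    using f fin by (intro integrableI_bounded) auto
  then show sq: "square_integrable M f" using f by (simp add: square_integrable_def)
  have "(L2_norm_on M f)\<^sup>2 \<le> B\<^sup>2"
    using le by (simp add: square_integrable_nn_integral[OF sq])
  then show "L2_norm_on M f \<le> B" using \<open>B \<ge> 0\<close> by (rule power2_le_imp_le)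
qed

lemma convolution_slab_bound:
  fixes K N1 N2 L1 L2 \<alpha> :: real
  assumes K: "K \<ge> 1" and N: "N1 \<ge> 1" "N2 \<ge> 1" "8 * K\<^sup>2 * N2 \<le> N1" and L: "L1 \<ge> 0" "L2 \<ge> 0"
    and \<alpha>: "\<alpha> \<le> 1" "N1 powr \<alpha> \<le> max L1 L2"
    and f: "square_integrable freq_measure f1" "square_integrable freq_measure f2"
    and supp: "\<And>z. f1 z \<noteq> 0 \<Longrightarrow> z \<in> slab K N1 L1" "\<And>z. f2 z \<noteq> 0 \<Longrightarrow> z \<in> slab K N2 L2"
  defines "B \<equiv> 28 * K ^ 4 * (N2 powr (1/2) * N1 powr (- \<alpha>/2) + N2 powr (1/4) * N1 powr (- \<alpha>/4)) *
           ((L1 powr (1/2) * L2_norm_on freq_measure f1) * (L2 powr (1/2) * L2_norm_on freq_measure f2))"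
  shows "square_integrable freq_measure (convolution f1 f2)"
    and "L2_norm_on freq_measure (convolution f1 f2) \<le> B"
proof -
  define W where "W = N2 powr (1/2) * N1 powr (- \<alpha>/2) + N2 powr (1/4) * N1 powr (- \<alpha>/4)"
  define m where "m = 2 * K * min L1 L2 * (128 * K ^ 5 *
    (N2 + sqrt (2 * K * max L1 L2 * N2) + 2 * K * max L1 L2 * N2 / N1))"
  define F1 F2 where "F1 = L2_norm_on freq_measure f1" and "F2 = L2_norm_on freq_measure f2"
  have m_le: "m \<le> (28 * K ^ 4 * W)\<^sup>2 * (L1 * L2)"
  proof -
    have "m \<le> 2 * K * min L1 L2 * (128 * K ^ 5 * (3 * K * max L1 L2 * W\<^sup>2))"
      unfolding m_def W_def using K L by (intro mult_left_mono count_le_weight N \<alpha>) auto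
    \<comment> \<open>Minimum times maximum is the product \<open>L1 * L2\<close>, and
      \<open>2 * 128 * 3 = 768\<close>. The next step rounds up to the squares
      \<open>784 = 28\<^sup>2\<close> and \<open>K ^ 8\<close>.\<close>
    also have "\<dots> = 768 * (K ^ 7 * W\<^sup>2 * (L1 * L2))"
      by (simp add: eval_nat_numeral min_def max_def)
    also have "\<dots> \<le> 784 * (K ^ 8 * W\<^sup>2 * (L1 * L2))"
      using K L by (intro mult_mono mult_right_mono power_increasing mult_nonneg_nonneg) auto
    also have "\<dots> = (28 * K ^ 4 * W)\<^sup>2 * (L1 * L2)" by (simp add: eval_nat_numeral)
    finally show ?thesis .
  qed
  have meas: "f1 \<in> borel_measurable freq_measure" "f2 \<in> borel_measurable freq_measure"
    using f by (auto simp: square_integrable_def)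
  note bound = convolution_freq_L2_bound[OF meas sets_slab sets_slab supp emeasure_slab_overlap_le[OF K N L]]
  have B0: "B \<ge> 0" using K unfolding B_def by (simp add: L2_norm_on_nonneg)
  have "(\<integral>\<^sup>+z. ennreal ((cmod (convolution f1 f2 z))\<^sup>2) \<partial>freq_measure)
      \<le> ennreal m * (ennreal (F1\<^sup>2) * ennreal (F2\<^sup>2))"
    using bound(2) unfolding square_integrable_nn_integral[OF f(1)] square_integrable_nn_integral[OF f(2)]
    by (simp add: m_def F1_def F2_def)
  also have "\<dots> \<le> ennreal ((28 * K ^ 4 * W)\<^sup>2 * (L1 * L2)) * (ennreal (F1\<^sup>2) * ennreal (F2\<^sup>2))"
    by (intro mult_right_mono ennreal_leI m_le) simp
  also have "\<dots> = ennreal ((28 * K ^ 4 * W)\<^sup>2 * (L1 * L2) * (F1\<^sup>2 * F2\<^sup>2))"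
    using L by (simp add: ennreal_mult)
  also have "(28 * K ^ 4 * W)\<^sup>2 * (L1 * L2) * (F1\<^sup>2 * F2\<^sup>2) = B\<^sup>2"
  proof -
    have "(L powr (1/2))\<^sup>2 = L" if "L \<ge> 0" for L :: real
      using that by (simp add: powr_half_sqrt)
    with L show ?thesis
      unfolding B_def W_def[symmetric] F1_def[symmetric] F2_def[symmetric]
      by (simp add: power_mult_distrib mult_ac)
  qed
  finally have le: "(\<integral>\<^sup>+z. ennreal ((cmod (convolution f1 f2 z))\<^sup>2) \<partial>freq_measure) \<le> ennreal (B\<^sup>2)" .
  show "square_integrable freq_measure (convolution f1 f2)"
    "L2_norm_on freq_measure (convolution f1 f2) \<le> B"
    using square_integrable_L2_norm_le[OF bound(1) B0 le] by auto
qed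

lemma dyadic_ge_1: "x \<in> dyadic \<Longrightarrow> x \<ge> 1"
  by (auto simp: dyadic_def)

lemma convolution_estimate:
  fixes K D N1 N2 L1 L2 \<alpha> :: real and f1 f2 :: "real \<times> int \<times> int \<Rightarrow> complex"
  assumes K: "K \<ge> 1" and D: "D \<ge> 2" and N: "N1 \<ge> 1" "N2 \<ge> 1" "8 * K\<^sup>2 * N2 \<le> N1"
    and L: "L1 \<ge> 0" "L2 \<ge> 0" and \<alpha>: "\<alpha> \<le> 1" "N1 powr \<alpha> \<le> max L1 L2"
    and f: "square_integrable freq_measure f1" "square_integrable freq_measure f2"
    and supp: "\<And>z1 z2. f1 z1 \<noteq> 0 \<Longrightarrow> f2 z2 \<noteq> 0 \<Longrightarrow> z1 \<in> slab K N1 L1 \<and> z2 \<in> slab K N2 L2"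
  shows "square_integrable freq_measure (convolution f1 f2) \<and>
    lesssim (28 * K ^ 4 / ln 2) (L2_norm_on freq_measure (convolution f1 f2))
      (ln D * (N2 powr (1/2) * N1 powr (- \<alpha>/2) + N2 powr (1/4) * N1 powr (- \<alpha>/4)) *
       ((L1 powr (1/2) * L2_norm_on freq_measure f1) * (L2 powr (1/2) * L2_norm_on freq_measure f2)))"
proof -
  define R where "R = (N2 powr (1/2) * N1 powr (- \<alpha>/2) + N2 powr (1/4) * N1 powr (- \<alpha>/4)) *
       ((L1 powr (1/2) * L2_norm_on freq_measure f1) * (L2 powr (1/2) * L2_norm_on freq_measure f2))"
  have R0: "R \<ge> 0" by (simp add: R_def L2_norm_on_nonneg)
  have main: "square_integrable freq_measure (convolution f1 f2) \<and>
      L2_norm_on freq_measure (convolution f1 f2) \<le> 28 * K ^ 4 * R"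
  \<comment> \<open>The support condition ranges over pairs of points, so it says nothing about one
    function if the other vanishes identically; the convolution is then zero.\<close>
  proof (cases "(\<exists>z. f1 z \<noteq> 0) \<and> (\<exists>z. f2 z \<noteq> 0)")
    case True
    then have "\<And>z. f1 z \<noteq> 0 \<Longrightarrow> z \<in> slab K N1 L1" "\<And>z. f2 z \<noteq> 0 \<Longrightarrow> z \<in> slab K N2 L2"
      using supp by blast+
    from convolution_slab_bound[OF K N L \<alpha> f this] show ?thesis by (simp add: R_def mult.assoc)
  next
    case False
    then have zero: "f1 w * f2 (z - w) = 0" for z w unfolding mult_eq_0_iff by blast
    have "convolution f1 f2 = (\<lambda>z. 0)"
      by (intro ext) (simp only: convolution_def zero Bochner_Integration.integral_zero)
    then show ?thesis using R0 K by (simp add: square_integrable_def L2_norm_on_def)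
  qed
  \<comment> \<open>The logarithm enters only here, through \<open>ln D \<ge> ln 2\<close>.\<close>
  have "28 * K ^ 4 * R * 1 \<le> 28 * K ^ 4 * R * (ln D / ln 2)"
    using D K R0 by (intro mult_left_mono) auto
  then show ?thesis using main by (simp add: lesssim_def R_def mult_ac)
qed

text \<open>\<open>K\<close> is a common implicit constant for all hypotheses. The smallness
  constant \<open>c\<close> is chosen from \<open>K\<close> before \<open>\<alpha>\<close>, and
  \<open>support_on\<close> is the set of nonzero values without closure.\<close>

theorem proposition4p4:
  fixes K :: real
  assumes "K \<ge> 1"
  shows "\<exists>c. 0 < c \<and> c < 1 \<and>
    (\<forall>\<alpha>::real. 0 < \<alpha> \<and> \<alpha> \<le> 1 \<longrightarrow>
      (\<exists>C>0. \<forall>(D::real) N1 N2 L1 L2 (f1 :: real \<times> int \<times> int \<Rightarrow> complex) f2.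
        D \<ge> 2 \<longrightarrow>
        N1 \<in> dyadic \<longrightarrow> N2 \<in> dyadic \<longrightarrow> L1 \<in> dyadic \<longrightarrow> L2 \<in> dyadic \<longrightarrow>
        lesssim c N2 N1 \<longrightarrow>
        N1 powr \<alpha> \<le> max L1 L2 \<longrightarrow>
        lesssim K (max L1 L2) (N1\<^sup>2 * N2) \<longrightarrow>
        square_integrable freq_measure f1 \<longrightarrow>
        square_integrable freq_measure f2 \<longrightarrow>
        (\<forall>(\<tau>1, \<xi>1, \<eta>1) \<in> support_on UNIV f1. \<forall>(\<tau>2, \<xi>2, \<eta>2) \<in> support_on UNIV f2.
           comparable K \<bar>real_of_int \<xi>1\<bar> N1 \<and> comparable K \<bar>real_of_int \<xi>2\<bar> N2 \<and>
           lesssim K \<bar>\<tau>1 - omega \<xi>1 \<eta>1\<bar> L1 \<and> lesssim K \<bar>\<tau>2 - omega \<xi>2 \<eta>2\<bar> L2 \<and>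
           lesssim K \<bar>real_of_int \<eta>1 / real_of_int \<xi>1 - real_of_int \<eta>2 / real_of_int \<xi>2\<bar> D) \<longrightarrow>
        square_integrable freq_measure (convolution f1 f2) \<and>
        lesssim C (L2_norm_on freq_measure (convolution f1 f2))
          (ln D * (N2 powr (1/2) * N1 powr (- \<alpha>/2) + N2 powr (1/4) * N1 powr (- \<alpha>/4)) *
           ((L1 powr (1/2) * L2_norm_on freq_measure f1) *
            (L2 powr (1/2) * L2_norm_on freq_measure f2)))))"
\<comment> \<open>This \<open>c\<close> makes \<open>lesssim c N2 N1\<close> exactly the separation
  \<open>8 * K\<^sup>2 * N2 \<le> N1\<close> required by the lattice count.\<close>
proof (rule exI[of _ "1 / (8 * K\<^sup>2)"], intro conjI allI impI, goal_cases)
  case 1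
  then show ?case using assms by simp
next
  case 2
  have "8 * K\<^sup>2 > 1" using one_le_power[OF assms, of 2] by simp
  then show ?case by (subst pos_divide_less_eq) linarith+
next
  case \<alpha>: (3 \<alpha>)
  show ?case
  proof (rule exI[of _ "28 * K ^ 4 / ln 2"], intro conjI[of "_ > (0::real)"] allI impI, goal_cases)
    case 1
    then show ?case using assms by simp
  next
    case (2 D N1 N2 L1 L2 f1 f2)
    have "8 * K\<^sup>2 * N2 \<le> N1"
      using 2(6) assms by (simp add: lesssim_def field_simps)
    moreover have "z1 \<in> slab K N1 L1 \<and> z2 \<in> slab K N2 L2" if "f1 z1 \<noteq> 0" "f2 z2 \<noteq> 0" for z1 z2
      using 2(11) that assms
      by (cases z1; cases z2) (force simp: support_on_def slab_def comparable_def lesssim_def pos_divide_le_eq mult.commute)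
    ultimately show ?case
      using 2 \<alpha> assms dyadic_ge_1
      by (intro convolution_estimate) (auto intro: order_trans[OF zero_le_one])
  qed
qed

end
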